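(* Let $\{\mathbf{x}^{k}\}_{k\ge 0}$ be a sequence generated by the CBCG-B method (cyclic block conditional gradient with backtracking). Then, for any $k\ge 0$, $$H(\mathbf{x}^{k})-H^{\ast}\le\frac{NC_3}{k+4}\qquad\text{and}\qquad\min_{n=0,1,\dots,k}S(\mathbf{x}^{n})\le\frac{2NC_3}{k+4},$$ where $$C_3=4\left[\max_{i=1,\dots,N}\max\left\{\bar\beta_i\|\mathbf{A}_i\|^2D_i^2,\,K_i\right\}+\frac{NL_F^2D^2\max_{i=1,\dots,N}\|\mathbf{A}_i\|^2}{\beta_{\mathrm{init}}}\right],\qquad \bar\beta_i=\max\{\kappa\beta_i,\beta_{\mathrm{init}}\}.$$
   Context: Setting. $\|\cdot\|$ is the Euclidean norm for vectors and the spectral norm for matrices. A vector $\mathbf{x}\in\mathbb{R}^{d}$ is partitioned into $N$ blocks $\mathbf{x}=(\mathbf{x}_1,\dots,\mathbf{x}_N)$, $\mathbf{x}_i\in\mathbb{R}^{n_i}$, $\sum_i n_i=d$; $\mathbf{U}_i\in\mathbb{R}^{d\times n_i}$ is the submatrix of the identity consisting of the columns of block $i$, so $\mathbf{x}_i=\mathbf{U}_i^T\mathbf{x}$ and $\mathbf{x}=\sum_i\mathbf{U}_i\mathbf{x}_i$. Let $\mathbf{A}\in\mathbb{R}^{m\times d}$ and $\mathbf{A}_i=\mathbf{A}\mathbf{U}_i$. Assumptions: (1) each $g_i:\mathbb{R}^{n_i}\to(-\infty,\infty]$ is proper, closed and convex, its domain $X_i=\mathrm{dom}\,g_i$ is compact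 with diameter $D_i$, and $g_i$ is Lipschitz on $X_i$ with constant $l_i$. Put $X=X_1\times\cdots\times X_N$, with diameter $D$, $D^2=\sum_i D_i^2$. (2) $F:\mathbb{R}^m\to\mathbb{R}$ is convex and continuously differentiable over $\mathbf{A}(X)$ (i.e. continuously differentiable on an open set containing it), and $\nabla F$ is Lipschitz on $\mathbf{A}(X)$ with constant $L_F$. (3) For each $i$ there is a constant $\beta_i>0$ with $\|\nabla F(\mathbf{A}\mathbf{x}+\mathbf{A}_i\mathbf{h}_i)-\nabla F(\mathbf{A}\mathbf{x})\|\le\beta_i\|\mathbf{A}_i\mathbf{h}_i\|$ for all $\mathbf{x}\in X$, $\mathbf{h}_i\in\mathbb{R}^{n_i}$ with $\mathbf{x}+\mathbf{U}_i\mathbf{h}_i\in X$. Notation: $f(\mathbf{x})=F(\mathbf{A}\mathbf{x})$, $g(\mathbf{x})=\sum_i g_i(\mathbf{x}_i)$, $H=f+g$, $\nabla_i f(\mathbf{x})=\mathbf{U}_i^T\nabla f(\mathbf{x})=\mathbf{A}_i^T\nabla F(\mathbf{A}\mathbf{x})$, $H^{\ast}=\min H$ (attained). $M_i=\max_{\mathbf{x}\in X}\|\nabla_i f(\mathbf{x})\|$, $K_i=(M_i+l_i)D_i$. Optimality measures: for $\mathbf{x}\in X$, $S(\mathbf{x})=\max_{\mathbf{p}\in X}\{\langle\nabla f(\mathbf{x}),\mathbf{x}-\mathbf{p}\rangle+g(\mathbf{x})-g(\mathbf{p})\}$ and $S_i(\mathbf{x})=\max_{\mathbf{p}_i\in X_i}\{\langle\nabla_i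 f(\mathbf{x}),\mathbf{x}_i-\mathbf{p}_i\rangle+g_i(\mathbf{x}_i)-g_i(\mathbf{p}_i)\}$. CBCG-B method: parameters $\beta_{\mathrm{init}}>0$, $\kappa>1$; start from any $\mathbf{x}^0\in X$ and $\xi_i^{-1}=0$ for all $i$. For $k=0,1,2,\dots$: set $\mathbf{x}^{k,0}=\mathbf{x}^k$; for $i=1,\dots,N$ in order: choose $\mathbf{p}_i^k\in\mathrm{argmin}_{\mathbf{p}_i\in X_i}\{\langle\nabla_i f(\mathbf{x}^{k,i-1}),\mathbf{p}_i\rangle+g_i(\mathbf{p}_i)\}$; for integers $\xi$ let $\alpha(\xi)=\min\left\{\frac{S_i(\mathbf{x}^{k,i-1})}{\kappa^{\xi}\beta_{\mathrm{init}}\|\mathbf{A}_i(\mathbf{p}_i^k-\mathbf{x}_i^{k,i-1})\|^2},1\right\}$ (taken to be $1$ if the denominator is zero); let $\xi_i^k$ be the smallest integer $\xi\ge\xi_i^{k-1}$ such that $H(\mathbf{x}^{k,i-1})-H(\mathbf{x}^{k,i-1}+\alpha(\xi)\mathbf{U}_i(\mathbf{p}_i^k-\mathbf{x}_i^{k,i-1}))\ge\frac{\alpha(\xi)}{2}S_i(\mathbf{x}^{k,i-1})$ (such an integer exists under the assumptions); set $\beta_i^k=\kappa^{\xi_i^k}\beta_{\mathrm{init}}$, $\alpha_i^k=\alpha(\xi_i^k)$, and $\mathbf{x}^{k,i}=\mathbf{x}^{k,i-1}+\alpha_i^k\mathbf{U}_i(\mathbf{p}_i^k-\mathbf{x}_i^{k,i-1})$.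 Then set $\mathbf{x}^{k+1}=\mathbf{x}^{k,N}$. *)

theory Defs
  imports "HOL-Analysis.Analysis"
begin

text \<open>
  The partition of the coordinates of \<open>real^'d\<close> into \<open>N\<close> blocks is a map \<open>blk :: 'd \<Rightarrow> nat\<close> with
  values in \<open>{1..N}\<close>; \<open>n\<^sub>i\<close> is the number of coordinates sent to \<open>i\<close>. Since the blocks have
  different dimensions, the space of the \<open>i\<close>-th block is realised isometrically as the coordinate
  subspace \<open>block_space blk i\<close> of \<open>real^'d\<close>, i.e. \<open>y\<close> is identified with \<open>U\<^sub>i y\<close>.
  Under this identification \<open>U\<^sub>i\<close> is the inclusion and its transpose is \<open>block_proj blk i\<close>.
\<close>

definition block_space :: "('d \<Rightarrow> nat) \<Rightarrow> nat \<Rightarrow> (real^'d::finite) set" where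
  "block_space blk i = {y. \<forall>j. blk j \<noteq> i \<longrightarrow> y $ j = 0}"

definition block_proj :: "('d \<Rightarrow> nat) \<Rightarrow> nat \<Rightarrow> real^'d::finite \<Rightarrow> real^'d" where
  "block_proj blk i x = (\<chi> j. if blk j = i then x $ j else 0)"

text \<open>
  \<open>A\<^sub>i = A U\<^sub>i\<close>, with the columns outside block \<open>i\<close> padded by zeros; this changes neither the
  action on the block space nor the spectral norm.
\<close>

definition block_cols :: "('d \<Rightarrow> nat) \<Rightarrow> nat \<Rightarrow> real^'d::finite^'m::finite \<Rightarrow> real^'d^'m" where
  "block_cols blk i A = (\<chi> r c. if blk c = i then A $ r $ c else 0)"

definition spectral_norm :: "real^'d::finite^'m::finite \<Rightarrow> real" where
  "spectral_norm A = onorm (\<lambda>x. A *v x)"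

definition gradient :: "('a::real_inner \<Rightarrow> real) \<Rightarrow> 'a \<Rightarrow> 'a" where
  "gradient F x = (THE D. GDERIV F x :> D)"

definition continuously_differentiable_over :: "'a::euclidean_space set \<Rightarrow> ('a \<Rightarrow> real) \<Rightarrow> bool" where
  "continuously_differentiable_over S F \<longleftrightarrow>
     (\<exists>V. open V \<and> S \<subseteq> V \<and> (\<forall>y\<in>V. F differentiable (at y)) \<and> continuous_on V (gradient F))"

text \<open>Extended real valued functions on a subspace \<open>V\<close>; values outside \<open>V\<close> are irrelevant.\<close>

definition ereal_epigraph :: "'a set \<Rightarrow> ('a \<Rightarrow> ereal) \<Rightarrow> ('a \<times> real) set" where
  "ereal_epigraph V h = {(y, t). y \<in> V \<and> h y \<le> ereal t}"

definition ereal_dom :: "'a set \<Rightarrow> ('a \<Rightarrow> ereal) \<Rightarrow> 'a set" where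
  "ereal_dom V h = {y \<in> V. h y < \<infinity>}"

definition proper_on :: "'a set \<Rightarrow> ('a \<Rightarrow> ereal) \<Rightarrow> bool" where
  "proper_on V h \<longleftrightarrow> (\<forall>y\<in>V. h y \<noteq> -\<infinity>) \<and> ereal_dom V h \<noteq> {}"

definition closed_fun_on :: "'a::topological_space set \<Rightarrow> ('a \<Rightarrow> ereal) \<Rightarrow> bool" where
  "closed_fun_on V h \<longleftrightarrow> closed (ereal_epigraph V h)"

definition convex_fun_on :: "'a::real_vector set \<Rightarrow> ('a \<Rightarrow> ereal) \<Rightarrow> bool" where
  "convex_fun_on V h \<longleftrightarrow> convex (ereal_epigraph V h)"

text \<open>\<open>X\<^sub>i = dom g\<^sub>i\<close> and \<open>X = X\<^sub>1 \<times> \<dots> \<times> X\<^sub>N\<close>.\<close>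

definition block_dom :: "('d \<Rightarrow> nat) \<Rightarrow> (nat \<Rightarrow> real^'d::finite \<Rightarrow> ereal) \<Rightarrow> nat \<Rightarrow> (real^'d) set" where
  "block_dom blk g i = ereal_dom (block_space blk i) (g i)"

definition feasible :: "('d \<Rightarrow> nat) \<Rightarrow> nat \<Rightarrow> (nat \<Rightarrow> real^'d::finite \<Rightarrow> ereal) \<Rightarrow> (real^'d) set" where
  "feasible blk N g = {x. \<forall>i\<in>{1..N}. block_proj blk i x \<in> block_dom blk g i}"

definition smooth_part :: "real^'d::finite^'m::finite \<Rightarrow> (real^'m \<Rightarrow> real) \<Rightarrow> real^'d \<Rightarrow> real" where
  "smooth_part A F x = F (A *v x)"

definition separable_part ::
    "('d \<Rightarrow> nat) \<Rightarrow> nat \<Rightarrow> (nat \<Rightarrow> real^'d::finite \<Rightarrow> ereal) \<Rightarrow> real^'d \<Rightarrow> ereal" where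
  "separable_part blk N g x = (\<Sum>i=1..N. g i (block_proj blk i x))"

definition objective ::
    "('d \<Rightarrow> nat) \<Rightarrow> nat \<Rightarrow> real^'d::finite^'m::finite \<Rightarrow> (real^'m \<Rightarrow> real) \<Rightarrow>
     (nat \<Rightarrow> real^'d \<Rightarrow> ereal) \<Rightarrow> real^'d \<Rightarrow> ereal" where
  "objective blk N A F g x = ereal (smooth_part A F x) + separable_part blk N g x"

definition optimal_value ::
    "('d \<Rightarrow> nat) \<Rightarrow> nat \<Rightarrow> real^'d::finite^'m::finite \<Rightarrow> (real^'m \<Rightarrow> real) \<Rightarrow>
     (nat \<Rightarrow> real^'d \<Rightarrow> ereal) \<Rightarrow> ereal" where
  "optimal_value blk N A F g = (INF x. objective blk N A F g x)"

definition partial_gradient ::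
    "('d \<Rightarrow> nat) \<Rightarrow> real^'d::finite^'m::finite \<Rightarrow> (real^'m \<Rightarrow> real) \<Rightarrow> nat \<Rightarrow> real^'d \<Rightarrow> real^'d" where
  "partial_gradient blk A F i x = block_proj blk i (gradient (smooth_part A F) x)"

text \<open>
  The suprema below are maxima of continuous functions over nonempty compact sets; the function
  values of \<open>g\<close> occurring in them are finite, so that they can be taken as real numbers.
\<close>

definition opt_measure ::
    "('d \<Rightarrow> nat) \<Rightarrow> nat \<Rightarrow> real^'d::finite^'m::finite \<Rightarrow> (real^'m \<Rightarrow> real) \<Rightarrow>
     (nat \<Rightarrow> real^'d \<Rightarrow> ereal) \<Rightarrow> real^'d \<Rightarrow> real" where
  "opt_measure blk N A F g x =
     (SUP p\<in>feasible blk N g. gradient (smooth_part A F) x \<bullet> (x - p)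
        + real_of_ereal (separable_part blk N g x) - real_of_ereal (separable_part blk N g p))"

definition partial_opt_measure ::
    "('d \<Rightarrow> nat) \<Rightarrow> real^'d::finite^'m::finite \<Rightarrow> (real^'m \<Rightarrow> real) \<Rightarrow>
     (nat \<Rightarrow> real^'d \<Rightarrow> ereal) \<Rightarrow> nat \<Rightarrow> real^'d \<Rightarrow> real" where
  "partial_opt_measure blk A F g i x =
     (SUP p\<in>block_dom blk g i. partial_gradient blk A F i x \<bullet> (block_proj blk i x - p)
        + real_of_ereal (g i (block_proj blk i x)) - real_of_ereal (g i p))"

text \<open>The stepsize \<open>\<alpha>(\<xi>)\<close> for block \<open>i\<close> at the current point \<open>y\<close> with minimiser \<open>q\<close>.\<close>

definition cbcg_stepsize ::
    "('d \<Rightarrow> nat) \<Rightarrow> real^'d::finite^'m::finite \<Rightarrow> (real^'m \<Rightarrow> real) \<Rightarrow> (nat \<Rightarrow> real^'d \<Rightarrow> ereal) \<Rightarrow>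
     real \<Rightarrow> real \<Rightarrow> nat \<Rightarrow> real^'d \<Rightarrow> real^'d \<Rightarrow> int \<Rightarrow> real" where
  "cbcg_stepsize blk A F g \<beta>init \<kappa> i y q \<xi> =
     (let den = \<kappa> powi \<xi> * \<beta>init * (norm (block_cols blk i A *v (q - block_proj blk i y)))\<^sup>2
      in if den = 0 then 1 else min (partial_opt_measure blk A F g i y / den) 1)"

definition cbcg_sufficient_decrease ::
    "('d \<Rightarrow> nat) \<Rightarrow> nat \<Rightarrow> real^'d::finite^'m::finite \<Rightarrow> (real^'m \<Rightarrow> real) \<Rightarrow> (nat \<Rightarrow> real^'d \<Rightarrow> ereal) \<Rightarrow>
     nat \<Rightarrow> real^'d \<Rightarrow> real^'d \<Rightarrow> real \<Rightarrow> bool" where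
  "cbcg_sufficient_decrease blk N A F g i y q \<alpha> \<longleftrightarrow>
     objective blk N A F g y - objective blk N A F g (y + \<alpha> *\<^sub>R (q - block_proj blk i y))
       \<ge> ereal (\<alpha> / 2 * partial_opt_measure blk A F g i y)"

text \<open>
  \<open>x k i\<close> is the iterate \<open>x\<^sup>k\<^sup>,\<^sup>i\<close> (so \<open>x k 0\<close> is \<open>x\<^sup>k\<close>), \<open>p k i\<close> is \<open>p\<^sub>i\<^sup>k\<close> and \<open>\<xi> k i\<close> is \<open>\<xi>\<^sub>i\<^sup>k\<close>.
\<close>

definition cbcg_b_sequence ::
    "('d \<Rightarrow> nat) \<Rightarrow> nat \<Rightarrow> real^'d::finite^'m::finite \<Rightarrow> (real^'m \<Rightarrow> real) \<Rightarrow> (nat \<Rightarrow> real^'d \<Rightarrow> ereal) \<Rightarrow>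
     real \<Rightarrow> real \<Rightarrow> (nat \<Rightarrow> nat \<Rightarrow> real^'d) \<Rightarrow> (nat \<Rightarrow> nat \<Rightarrow> real^'d) \<Rightarrow> (nat \<Rightarrow> nat \<Rightarrow> int) \<Rightarrow> bool" where
  "cbcg_b_sequence blk N A F g \<beta>init \<kappa> x p \<xi> \<longleftrightarrow>
     x 0 0 \<in> feasible blk N g \<and>
     (\<forall>k. (\<forall>i\<in>{1..N}.
         let y = x k (i - 1);
             \<alpha> = cbcg_stepsize blk A F g \<beta>init \<kappa> i y (p k i);
             \<xi>prev = (if k = 0 then 0 else \<xi> (k - 1) i)
         in is_arg_min (\<lambda>q. ereal (partial_gradient blk A F i y \<bullet> q) + g i q)
              (\<lambda>q. q \<in> block_dom blk g i) (p k i)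
          \<and> is_arg_min id
              (\<lambda>z. \<xi>prev \<le> z \<and> cbcg_sufficient_decrease blk N A F g i y (p k i) (\<alpha> z)) (\<xi> k i)
          \<and> x k i = y + \<alpha> (\<xi> k i) *\<^sub>R (p k i - block_proj blk i y))
       \<and> x (Suc k) 0 = x k N)"

text \<open>The constants \<open>M\<^sub>i\<close>, \<open>K\<^sub>i\<close> and \<open>C\<^sub>3\<close>.\<close>

definition grad_bound ::
    "('d \<Rightarrow> nat) \<Rightarrow> nat \<Rightarrow> real^'d::finite^'m::finite \<Rightarrow> (real^'m \<Rightarrow> real) \<Rightarrow>
     (nat \<Rightarrow> real^'d \<Rightarrow> ereal) \<Rightarrow> nat \<Rightarrow> real" where
  "grad_bound blk N A F g i = (SUP x\<in>feasible blk N g. norm (partial_gradient blk A F i x))"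

definition K_const ::
    "('d \<Rightarrow> nat) \<Rightarrow> nat \<Rightarrow> real^'d::finite^'m::finite \<Rightarrow> (real^'m \<Rightarrow> real) \<Rightarrow>
     (nat \<Rightarrow> real^'d \<Rightarrow> ereal) \<Rightarrow> (nat \<Rightarrow> real) \<Rightarrow> nat \<Rightarrow> real" where
  "K_const blk N A F g l i = (grad_bound blk N A F g i + l i) * diameter (block_dom blk g i)"

definition C3_const ::
    "('d \<Rightarrow> nat) \<Rightarrow> nat \<Rightarrow> real^'d::finite^'m::finite \<Rightarrow> (real^'m \<Rightarrow> real) \<Rightarrow>
     (nat \<Rightarrow> real^'d \<Rightarrow> ereal) \<Rightarrow> (nat \<Rightarrow> real) \<Rightarrow> real \<Rightarrow> (nat \<Rightarrow> real) \<Rightarrow> real \<Rightarrow> real \<Rightarrow> real" where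
  "C3_const blk N A F g l LF \<beta> \<beta>init \<kappa> =
     4 * ((MAX i\<in>{1..N}. max (max (\<kappa> * \<beta> i) \<beta>init * (spectral_norm (block_cols blk i A))\<^sup>2
                                * (diameter (block_dom blk g i))\<^sup>2)
                             (K_const blk N A F g l i))
          + real N * LF\<^sup>2 * (diameter (feasible blk N g))\<^sup>2
              * (MAX i\<in>{1..N}. (spectral_norm (block_cols blk i A))\<^sup>2) / \<beta>init)"

end

theory Submission
  imports Defs
begin

text \<open>
  Write \<open>T(x) = \<Sum>\<^sub>i S\<^sub>i(x)\<close>, which bounds both \<open>S(x)\<close> and, by convexity, \<open>H(x) - H\<^sup>*\<close>.
  One block step started at \<open>y\<close> decreases \<open>H\<close> by at least a multiple of \<open>S\<^sub>i(y)\<^sup>2\<close>, since backtracking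
  keeps the curvature estimates below \<open>max {\<kappa> \<beta>\<^sub>i, \<beta>\<^sub>init}\<close>, and also by at least a multiple of the
  squared displacement of \<open>A x\<close>, since these estimates never drop below \<open>\<beta>\<^sub>init\<close>. The block measure
  at the start of a cycle differs from the one at \<open>y\<close> only through the gradient, hence by a multiple of the
  displacement of \<open>A x\<close> accumulated within the cycle. Altogether \<open>T(x\<^sup>k)\<^sup>2 \<le> N C\<^sub>3 (H(x\<^sup>k) - H(x\<^sup>k\<^sup>+\<^sup>1))\<close>,
  and this recursion forces both rates.
\<close>

section \<open>Gradients and convexity\<close>

lemma GDERIV_unique:
  assumes "GDERIV f x :> D" "GDERIV f x :> E"
  shows "D = E"
proof -
  have "(\<lambda>h. h \<bullet> D) = (\<lambda>h. h \<bullet> E)"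
    using assms unfolding gderiv_def by (rule has_derivative_unique)
  then have "(D - E) \<bullet> D = (D - E) \<bullet> E" by meson
  then have "(D - E) \<bullet> (D - E) = 0" by (simp add: inner_diff_right)
  then show ?thesis by simp
qed

lemma gradient_eqI: "GDERIV f x :> D \<Longrightarrow> gradient f x = D"
  unfolding gradient_def using GDERIV_unique by blast

lemma differentiable_imp_GDERIV_gradient:
  fixes f :: "'a::euclidean_space \<Rightarrow> real"
  assumes "f differentiable (at x)"
  shows "GDERIV f x :> gradient f x"
proof -
  obtain f' where f': "(f has_derivative f') (at x)"
    using assms by (auto simp: differentiable_def)
  \<comment> \<open>\<open>adjoint f' 1\<close> is the Riesz representative of the derivative
    \<open>f'\<close>.\<close>
  have "f' h = h \<bullet> adjoint f' 1" for h
    by (simp add: adjoint_works[OF has_derivative_linear[OF f']])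
  then have "GDERIV f x :> adjoint f' 1"
    using f' unfolding gderiv_def by (simp add: adjoint_works[OF has_derivative_linear[OF f']])
  then show ?thesis by (simp add: gradient_eqI)
qed

lemma has_real_derivative_along_line:
  fixes f :: "'a::euclidean_space \<Rightarrow> real"
  assumes "f differentiable (at (a + t *\<^sub>R d))"
  shows "((\<lambda>s. f (a + s *\<^sub>R d)) has_real_derivative gradient f (a + t *\<^sub>R d) \<bullet> d) (at t)"
proof -
  have "((\<lambda>s. a + s *\<^sub>R d) has_derivative (\<lambda>h. h *\<^sub>R d)) (at t)"
    by (auto intro!: derivative_eq_intros)
  then have "((\<lambda>s. f (a + s *\<^sub>R d)) has_derivative (\<lambda>h. (h *\<^sub>R d) \<bullet> gradient f (a + t *\<^sub>R d))) (at t)"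
    using differentiable_imp_GDERIV_gradient[OF assms] unfolding gderiv_def
    by (rule has_derivative_compose)
  moreover have "(\<lambda>h. (h *\<^sub>R d) \<bullet> gradient f (a + t *\<^sub>R d)) = (*) (gradient f (a + t *\<^sub>R d) \<bullet> d)"
    by (auto simp: inner_commute)
  ultimately show ?thesis
    unfolding has_field_derivative_def by simp
qed

text \<open>By convexity the difference quotients from \<open>u\<close> towards \<open>v\<close>
  never exceed \<open>f v - f u\<close>. The limit is taken from the right only, because
  \<open>S\<close> need not contain a neighbourhood of \<open>u\<close>.\<close>

lemma convex_on_gradient_inequality:
  fixes f :: "'a::euclidean_space \<Rightarrow> real"
  assumes conv: "convex_on S f" and uv: "u \<in> S" "v \<in> S"
    and diff: "f differentiable (at u)"
  shows "f u + gradient f u \<bullet> (v - u) \<le> f v"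
proof -
  define \<phi> where "\<phi> s = f (u + s *\<^sub>R (v - u))" for s
  have "(\<phi> has_real_derivative gradient f u \<bullet> (v - u)) (at 0)"
    unfolding \<phi>_def using has_real_derivative_along_line[of f u 0 "v - u"] diff by simp
  then have "((\<lambda>h. (\<phi> h - \<phi> 0) / h) \<longlongrightarrow> gradient f u \<bullet> (v - u)) (at_right 0)"
    by (auto simp: has_field_derivative_iff intro: tendsto_within_subset)
  moreover have "\<forall>\<^sub>F h in at_right 0. (\<phi> h - \<phi> 0) / h \<le> f v - f u"
  proof -
    have "(\<phi> h - \<phi> 0) / h \<le> f v - f u" if "0 < h" "h < 1" for h
    proof -
      have "\<phi> h = f ((1 - h) *\<^sub>R u + h *\<^sub>R v)"
        by (simp add: \<phi>_def algebra_simps)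
      also have "\<dots> \<le> (1 - h) * f u + h * f v"
        using convex_onD[OF conv] uv that by simp
      finally show ?thesis using that by (simp add: \<phi>_def field_simps)
    qed
    then show ?thesis
      unfolding eventually_at_right_field by (intro exI[of _ 1]) auto
  qed
  ultimately have "gradient f u \<bullet> (v - u) \<le> f v - f u"
    by (intro tendsto_upperbound) auto
  then show ?thesis by simp
qed

text \<open>Subtracting the quadratic model from \<open>f\<close> along the segment leaves a
  function with nonpositive derivative. Gradients are compared with the one at the base point
  \<open>a\<close> only, which is the form of the blockwise Lipschitz assumption.\<close>

lemma descent_along_segment:
  fixes f :: "'a::euclidean_space \<Rightarrow> real"
  assumes t: "0 \<le> t" "t \<le> 1"
    and diff: "\<And>s. \<lbrakk>0 \<le> s; s \<le> 1\<rbrakk> \<Longrightarrow> f differentiable (at (a + s *\<^sub>R d))"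
    and lip: "\<And>s. \<lbrakk>0 \<le> s; s \<le> 1\<rbrakk> \<Longrightarrow>
        norm (gradient f (a + s *\<^sub>R d) - gradient f a) \<le> L * norm (s *\<^sub>R d)"
  shows "f (a + t *\<^sub>R d) \<le> f a + t * (gradient f a \<bullet> d) + L / 2 * t\<^sup>2 * (norm d)\<^sup>2"
proof -
  define \<psi> where "\<psi> s = f (a + s *\<^sub>R d) - s * (gradient f a \<bullet> d) - L / 2 * s\<^sup>2 * (norm d)\<^sup>2" for s
  have "\<psi> t \<le> \<psi> 0"
  proof (rule DERIV_nonpos_imp_nonincreasing[OF t(1)])
    fix s assume s: "0 \<le> s" "s \<le> t"
    have "(\<psi> has_real_derivative
        (gradient f (a + s *\<^sub>R d) \<bullet> d - gradient f a \<bullet> d - L * s * (norm d)\<^sup>2)) (at s)"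
      unfolding \<psi>_def using has_real_derivative_along_line[OF diff[of s]] s t
      by (auto intro!: derivative_eq_intros)
    moreover have "(gradient f (a + s *\<^sub>R d) - gradient f a) \<bullet> d \<le> L * norm (s *\<^sub>R d) * norm d"
      using lip[of s] s t by (intro order_trans[OF norm_cauchy_schwarz]) (auto intro!: mult_right_mono)
    ultimately show "\<exists>y. (\<psi> has_real_derivative y) (at s) \<and> y \<le> 0"
      using s by (intro exI conjI) (auto simp: inner_diff_left power2_eq_square mult_ac)
  qed
  then show ?thesis by (simp add: \<psi>_def)
qed

section \<open>Extended-valued convex functions along segments\<close>

lemma ereal_dom_finite:
  assumes "proper_on V h" "y \<in> ereal_dom V h"
  shows "ereal (real_of_ereal (h y)) = h y"
  using assms by (auto simp: proper_on_def ereal_dom_def ereal_real)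

lemma convex_fun_on_segment:
  assumes conv: "convex_fun_on V h" and proper: "proper_on V h"
    and u: "u \<in> ereal_dom V h" and v: "v \<in> ereal_dom V h" and t: "0 \<le> t" "t \<le> 1"
  shows "(1 - t) *\<^sub>R u + t *\<^sub>R v \<in> ereal_dom V h"
    and "real_of_ereal (h ((1 - t) *\<^sub>R u + t *\<^sub>R v))
      \<le> (1 - t) * real_of_ereal (h u) + t * real_of_ereal (h v)"
proof -
  let ?w = "(1 - t) *\<^sub>R u + t *\<^sub>R v"
  let ?c = "(1 - t) * real_of_ereal (h u) + t * real_of_ereal (h v)"
  have epi: "(y, real_of_ereal (h y)) \<in> ereal_epigraph V h" if "y \<in> ereal_dom V h" for y
    using that ereal_dom_finite[OF proper that] by (auto simp: ereal_epigraph_def ereal_dom_def)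
  \<comment> \<open>Convexity is that of the epigraph, so it is applied to the two graph points,
    whose heights are real by properness.\<close>
  have "(1 - t) *\<^sub>R (u, real_of_ereal (h u)) + t *\<^sub>R (v, real_of_ereal (h v)) \<in> ereal_epigraph V h"
    using conv t epi[OF u] epi[OF v] unfolding convex_fun_on_def by (intro convexD) auto
  then have w: "?w \<in> V" "h ?w \<le> ereal ?c"
    by (auto simp: ereal_epigraph_def)
  then show dom: "?w \<in> ereal_dom V h"
    by (auto simp: ereal_dom_def)
  show "real_of_ereal (h ?w) \<le> ?c"
    using w(2) ereal_dom_finite[OF proper dom] by (metis ereal_less_eq(3))
qed

section \<open>Rates from a quadratic recursion\<close>

text \<open>With \<open>b = a n / Q\<close> the recursion says that the next ratio is at most
  \<open>b - b^2\<close>. This map increases up to 1/2, and the shift by 4 keeps \<open>b\<close>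
  below 1/4, so the worst case is \<open>b = 1/m\<close>, where
  \<open>1/m - 1/m^2 \<le> 1/(m+1)\<close>.\<close>

lemma sublinear_rate:
  fixes a :: "nat \<Rightarrow> real"
  assumes nonneg: "\<And>n. 0 \<le> a n" and init: "a 0 \<le> Q / 4"
    and rec: "\<And>n. (a n)\<^sup>2 \<le> Q * (a n - a (Suc n))"
  shows "a n \<le> Q / (real n + 4)"
proof (cases "Q = 0")
  case True
  then show ?thesis using rec[of n] by simp
next
  case False
  then have Q: "0 < Q" using init nonneg[of 0] by linarith
  show ?thesis
  proof (induction n)
    case 0
    then show ?case using init by simp
  next
    case (Suc n)
    define m where "m = real n + 4"
    define b where "b = a n / Q"
    have b: "0 \<le> b" "b * m \<le> 1" "m \<ge> 4"
      using Suc Q nonneg[of n] by (auto simp: b_def m_def field_simps)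
    have an: "a n = Q * b" using Q by (simp add: b_def)
    have "Q * a (Suc n) \<le> Q * (Q * (b - b\<^sup>2))"
      using rec[of n] unfolding an by (simp add: algebra_simps power2_eq_square)
    then have "a (Suc n) \<le> Q * (b - b\<^sup>2)" using Q by simp
    moreover have "b - b\<^sup>2 \<le> 1 / (m + 1)"
    proof -
      have "(m + 1) * (b - b\<^sup>2) \<le> 1"
      proof -
        define e where "e = 1 - b * m"
        have "0 \<le> e" using b by (simp add: e_def)
        \<comment> \<open>Expanding in the slack \<open>e\<close> of the induction hypothesis makes
          every term visibly nonnegative.\<close>
        have "m\<^sup>2 * (1 - (m + 1) * (b - b\<^sup>2)) = e * (m - 2) * (m + 1) + (m + 1) * e\<^sup>2 + 1"
          unfolding e_def by (simp add: algebra_simps power2_eq_square)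
        also have "\<dots> \<ge> 0" using b \<open>0 \<le> e\<close> by simp
        finally have "0 \<le> m\<^sup>2 * (1 - (m + 1) * (b - b\<^sup>2))" .
        then show ?thesis using b by (simp add: zero_le_mult_iff)
      qed
      then show ?thesis using b by (simp add: field_simps)
    qed
    ultimately have "a (Suc n) \<le> Q * (1 / (m + 1))"
      using Q by (meson mult_left_mono less_imp_le order_trans)
    then show ?case by (simp add: m_def add_ac)
  qed
qed

lemma sublinear_rate_min:
  fixes a T :: "nat \<Rightarrow> real"
  assumes nonneg: "\<And>n. 0 \<le> a n" and init: "a 0 \<le> Q / 4"
    and le: "\<And>n. a n \<le> T n"
    and rec: "\<And>n. (T n)\<^sup>2 \<le> Q * (a n - a (Suc n))"
  shows "\<exists>n\<le>k. T n \<le> 2 * Q / (real k + 4)"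
proof (rule ccontr)
  assume contr: "\<not> ?thesis"
  have Q: "0 \<le> Q" using init nonneg[of 0] by linarith
  have rec_a: "(a n)\<^sup>2 \<le> Q * (a n - a (Suc n))" for n
    using power_mono[OF le nonneg, of n 2] rec[of n] by linarith
  \<comment> \<open>Averaging over \<open>{m..k}\<close> gives \<open>(T n)\<^sup>2 \<le> Q\<^sup>2 / ((m + 4) * (k + 1 - m))\<close> for some \<open>n\<close>;
      this \<open>m\<close> (which is \<open>0\<close> for \<open>k < 3\<close> by truncation) balances the two factors.\<close>
  define m where "m = (k - 3) div 2"
  define c where "c = 2 * Q / (real k + 4)"
  have c: "0 \<le> c" using Q by (simp add: c_def)
  have m: "m \<le> k" by (simp add: m_def)
  have big: "c < T n" if "n \<le> k" for n
    using contr that unfolding c_def by (meson not_le)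
  have "(\<Sum>n=m..k. c\<^sup>2) < (\<Sum>n=m..k. (T n)\<^sup>2)"
    using big c m by (intro sum_strict_mono power_strict_mono) auto
  also have "\<dots> \<le> (\<Sum>n=m..k. Q * (a n - a (Suc n)))"
    by (intro sum_mono rec)
  also have "\<dots> = Q * (a m - a (Suc k))"
    using sum_Suc_diff[of m k "\<lambda>n. - a n"] m by (simp add: sum_distrib_left[symmetric])
  also have "\<dots> \<le> Q * (Q / (real m + 4))"
    using sublinear_rate[OF nonneg init rec_a, of m] nonneg[of "Suc k"] Q
    by (intro mult_left_mono) auto
  finally have lt: "(real k + 1 - real m) * c\<^sup>2 < Q * (Q / (real m + 4))"
    using m by (simp add: of_nat_diff add.commute)
  \<comment> \<open>For \<open>k \<ge> 3\<close> the factors are \<open>m + 4\<close> and either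
    \<open>m + 4\<close> or \<open>m + 5\<close>, both at least half of \<open>k + 4\<close>. For
    smaller \<open>k\<close> the window starts at 0, and \<open>k = 0\<close> gives
    equality.\<close>
  have "(real k + 4)\<^sup>2 \<le> 4 * ((real m + 4) * (real k + 1 - real m))"
  proof (cases "k < 3")
    case True
    then have "k = 0 \<or> k = 1 \<or> k = 2" by auto
    then show ?thesis by (auto simp: m_def power2_eq_square)
  next
    case False
    then have "k = 2 * m + 3 \<or> k = 2 * m + 4" unfolding m_def by presburger
    then show ?thesis by (auto simp: power2_eq_square algebra_simps)
  qed
  then have "Q\<^sup>2 * (real k + 4)\<^sup>2 \<le> Q\<^sup>2 * (4 * ((real m + 4) * (real k + 1 - real m)))"
    by (intro mult_left_mono) auto
  moreover have "(real k + 1 - real m) * (2 * Q)\<^sup>2 * (real m + 4) < Q * Q * (real k + 4)\<^sup>2"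
    using lt by (simp add: c_def power_divide field_simps)
  ultimately show False by (simp add: power2_eq_square algebra_simps)
qed

section \<open>Block coordinates\<close>

lemma linear_block_proj: "linear (block_proj blk i)"
  by (rule linearI) (auto simp: block_proj_def vec_eq_iff)

lemmas block_proj_add = linear_add[OF linear_block_proj]
  and block_proj_diff = linear_diff[OF linear_block_proj]
  and block_proj_scaleR = linear_scale[OF linear_block_proj]

lemma block_proj_in_block_space: "block_proj blk i x \<in> block_space blk i"
  by (simp add: block_proj_def block_space_def)

lemma block_proj_block_space:
  assumes "y \<in> block_space blk i"
  shows "block_proj blk j y = (if j = i then y else 0)"
  using assms by (auto simp: block_proj_def block_space_def vec_eq_iff)

lemma inner_block_proj_left: "block_proj blk i x \<bullet> y = x \<bullet> block_proj blk i y"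
  unfolding inner_vec_def block_proj_def by (intro sum.cong) auto

lemma sum_block_proj:
  assumes "range blk \<subseteq> {1..N}"
  shows "(\<Sum>i=1..N. block_proj blk i x) = x"
proof -
  have "(\<Sum>i=1..N. block_proj blk i x $ j) = x $ j" for j
  proof -
    have "blk j \<in> {1..N}" using assms by blast
    then show ?thesis by (simp add: block_proj_def)
  qed
  then show ?thesis by (simp add: vec_eq_iff)
qed

text \<open>Pythagoras: block projections are self-adjoint and idempotent, so \<open>x\<close>
  paired with its i-th component gives the squared length of that component.\<close>

lemma norm_squared_sum_block_proj:
  assumes "range blk \<subseteq> {1..N}"
  shows "(norm x)\<^sup>2 = (\<Sum>i=1..N. (norm (block_proj blk i x))\<^sup>2)"
proof -
  have "(norm x)\<^sup>2 = x \<bullet> (\<Sum>i=1..N. block_proj blk i x)"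
    by (simp only: sum_block_proj[OF assms] power2_norm_eq_inner)
  also have "\<dots> = (\<Sum>i=1..N. block_proj blk i x \<bullet> block_proj blk i x)"
    unfolding inner_sum_right
    by (intro sum.cong)
      (auto simp: inner_block_proj_left block_proj_block_space[OF block_proj_in_block_space])
  finally show ?thesis by (simp add: power2_norm_eq_inner)
qed

text \<open>For \<open>v\<close> in the i-th block space the right side is \<open>A *v v\<close>;
  this is how the padded matrix is traded for \<open>A\<close> in the estimates.\<close>

lemma block_cols_mult: "block_cols blk i A *v v = A *v block_proj blk i v"
  by (auto simp: block_cols_def block_proj_def matrix_vector_mult_def vec_eq_iff intro!: sum.cong)

lemma norm_mult_block_space_le:
  assumes "h \<in> block_space blk i"
  shows "norm (A *v h) \<le> spectral_norm (block_cols blk i A) * norm h"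
proof -
  have "A *v h = block_cols blk i A *v h"
    using assms by (simp add: block_cols_mult block_proj_block_space)
  then show ?thesis
    unfolding spectral_norm_def by (simp add: onorm)
qed

lemma spectral_norm_nonneg: "0 \<le> spectral_norm A"
  unfolding spectral_norm_def by (simp add: onorm_pos_le)

section \<open>Optimality measures of the composite problem\<close>

locale block_composite_problem =
  fixes blk :: "'d::finite \<Rightarrow> nat" and N :: nat
    and A :: "real^'d^'m::finite" and F :: "real^'m \<Rightarrow> real"
    and g :: "nat \<Rightarrow> real^'d \<Rightarrow> ereal"
    and l :: "nat \<Rightarrow> real" and LF :: real
  assumes blocks: "range blk \<subseteq> {1..N}"
    and g_proper: "\<And>i. i \<in> {1..N} \<Longrightarrow> proper_on (block_space blk i) (g i)"
    and g_convex: "\<And>i. i \<in> {1..N} \<Longrightarrow> convex_fun_on (block_space blk i) (g i)"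
    and dom_compact: "\<And>i. i \<in> {1..N} \<Longrightarrow> compact (block_dom blk g i)"
    and g_lipschitz: "\<And>i. i \<in> {1..N} \<Longrightarrow>
          (l i)-lipschitz_on (block_dom blk g i) (\<lambda>y. real_of_ereal (g i y))"
    and F_convex: "convex_on ((*v) A ` feasible blk N g) F"
    and F_C1: "continuously_differentiable_over ((*v) A ` feasible blk N g) F"
    and gradF_lipschitz: "LF-lipschitz_on ((*v) A ` feasible blk N g) (gradient F)"
begin

abbreviation "P \<equiv> block_proj blk"
abbreviation "X \<equiv> feasible blk N g"
abbreviation "Xi \<equiv> block_dom blk g"
abbreviation "G i y \<equiv> real_of_ereal (g i y)"
abbreviation "S \<equiv> partial_opt_measure blk A F g"
abbreviation "D i \<equiv> diameter (Xi i)"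
abbreviation "sn i \<equiv> spectral_norm (block_cols blk i A)"
abbreviation "K \<equiv> K_const blk N A F g l"
abbreviation "pgrad \<equiv> partial_gradient blk A F"

text \<open>Real-valued stand-in for \<open>objective\<close>, meaningful on \<open>X\<close> only:
  elsewhere \<open>real_of_ereal\<close> turns an infinite value into 0.\<close>

definition "H x = F (A *v x) + (\<Sum>i=1..N. G i (P i x))"

section \<open>The feasible set as a product of block domains\<close>

lemma N_pos: "1 \<le> N"
  \<comment> \<open>The index type \<open>'d\<close> is nonempty, so some coordinate has its block
    number in \<open>{1..N}\<close>.\<close>
  using blocks by fastforce

lemma block_dom_subset: "y \<in> Xi i \<Longrightarrow> y \<in> block_space blk i"
  by (simp add: block_dom_def ereal_dom_def)

lemma diff_block_proj_in_block_space:
  assumes "q \<in> Xi i"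
  shows "q - P i y \<in> block_space blk i" and "P i y - q \<in> block_space blk i"
  using block_dom_subset[OF assms] block_proj_in_block_space[of blk i y]
  by (simp_all add: block_space_def)

lemma block_dom_nonempty: "i \<in> {1..N} \<Longrightarrow> Xi i \<noteq> {}"
  using g_proper by (simp add: block_dom_def proper_on_def)

lemma g_finite: "\<lbrakk>i \<in> {1..N}; y \<in> Xi i\<rbrakk> \<Longrightarrow> ereal (G i y) = g i y"
  using ereal_dom_finite[OF g_proper] by (simp add: block_dom_def)

lemma feasibleD: "\<lbrakk>x \<in> X; i \<in> {1..N}\<rbrakk> \<Longrightarrow> P i x \<in> Xi i"
  by (simp add: feasible_def)

lemma feasible_sum:
  assumes "\<And>i. i \<in> {1..N} \<Longrightarrow> y i \<in> Xi i"
  shows "(\<Sum>i=1..N. y i) \<in> X" and "i \<in> {1..N} \<Longrightarrow> P i (\<Sum>i=1..N. y i) = y i"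
proof -
  have *: "P i (\<Sum>i=1..N. y i) = y i" if i: "i \<in> {1..N}" for i
  proof -
    have "P i (\<Sum>j=1..N. y j) = (\<Sum>j=1..N. if j = i then y j else 0)"
      unfolding linear_sum[OF linear_block_proj]
      by (intro sum.cong) (auto simp: block_proj_block_space[OF block_dom_subset[OF assms]])
    then show ?thesis using i by simp
  qed
  then show "i \<in> {1..N} \<Longrightarrow> P i (\<Sum>i=1..N. y i) = y i" .
  show "(\<Sum>i=1..N. y i) \<in> X"
    using * assms by (simp add: feasible_def)
qed

lemma bounded_block_dom: "i \<in> {1..N} \<Longrightarrow> bounded (Xi i)"
  by (simp add: dom_compact compact_imp_bounded)

lemma dist_block_dom:
  "\<lbrakk>i \<in> {1..N}; u \<in> Xi i; v \<in> Xi i\<rbrakk> \<Longrightarrow> norm (u - v) \<le> D i"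
  using diameter_bounded_bound[OF bounded_block_dom] by (simp add: dist_norm)

lemma bounded_feasible: "bounded X"
proof -
  have "\<forall>i\<in>{1..N}. \<exists>B. \<forall>y\<in>Xi i. norm y \<le> B"
    using bounded_block_dom by (auto simp: bounded_iff)
  then obtain B where B: "norm y \<le> B i" if "i \<in> {1..N}" "y \<in> Xi i" for i y
    by metis
  have "norm x \<le> (\<Sum>i=1..N. B i)" if "x \<in> X" for x
  proof -
    have "norm x = norm (\<Sum>i=1..N. P i x)"
      by (simp only: sum_block_proj[OF blocks])
    also have "\<dots> \<le> (\<Sum>i=1..N. norm (P i x))" by (rule norm_sum)
    also have "\<dots> \<le> (\<Sum>i=1..N. B i)"
      using B feasibleD[OF that] by (intro sum_mono) auto
    finally show ?thesis .
  qed
  then show ?thesis by (auto simp: bounded_iff)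
qed

text \<open>Each block diameter is attained by compactness. Gluing the extremal pairs over all
  blocks gives two feasible points whose squared distance is the left side.\<close>

lemma sum_squared_diameter: "(\<Sum>i=1..N. (D i)\<^sup>2) \<le> (diameter X)\<^sup>2"
proof -
  have "\<forall>i\<in>{1..N}. \<exists>u v. u \<in> Xi i \<and> v \<in> Xi i \<and> dist u v = D i"
    using diameter_compact_attained dom_compact block_dom_nonempty by meson
  then obtain u v where uv: "u i \<in> Xi i" "v i \<in> Xi i" "dist (u i) (v i) = D i"
    if "i \<in> {1..N}" for i
    by metis
  let ?u = "\<Sum>i=1..N. u i" and ?v = "\<Sum>i=1..N. v i"
  have "(\<Sum>i=1..N. (D i)\<^sup>2) = (norm (?u - ?v))\<^sup>2"
    unfolding norm_squared_sum_block_proj[OF blocks, of "?u - ?v"]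
  proof (rule sum.cong)
    fix i assume i: "i \<in> {1..N}"
    have "P i ?u = u i" using uv(1) i by (intro feasible_sum(2))
    moreover have "P i ?v = v i" using uv(2) i by (intro feasible_sum(2))
    ultimately show "(D i)\<^sup>2 = (norm (P i (?u - ?v)))\<^sup>2"
      using uv(3)[OF i] by (simp add: dist_norm block_proj_diff)
  qed simp
  also have "\<dots> \<le> (diameter X)\<^sup>2"
  proof (rule power_mono)
    have "?u \<in> X" by (rule feasible_sum(1)) (rule uv(1))
    moreover have "?v \<in> X" by (rule feasible_sum(1)) (rule uv(2))
    ultimately show "norm (?u - ?v) \<le> diameter X"
      using diameter_bounded_bound[OF bounded_feasible, of ?u ?v] by (simp add: dist_norm)
  qed simp
  finally show ?thesis .
qed

section \<open>Gradients of the smooth part\<close>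

lemma F_differentiable: "x \<in> X \<Longrightarrow> F differentiable (at (A *v x))"
  using F_C1 unfolding continuously_differentiable_over_def by blast

lemma gradient_smooth_part:
  assumes "x \<in> X"
  shows "gradient (smooth_part A F) x \<bullet> v = gradient F (A *v x) \<bullet> (A *v v)"
proof -
  have lin: "((*v) A has_derivative (*v) A) (at x)"
    by (simp add: bounded_linear_imp_has_derivative)
  have "(smooth_part A F has_derivative (\<lambda>h. (A *v h) \<bullet> gradient F (A *v x))) (at x)"
    using has_derivative_compose[OF lin
        differentiable_imp_GDERIV_gradient[OF F_differentiable[OF assms], unfolded gderiv_def]]
    by (simp add: smooth_part_def[abs_def])
  moreover have "(A *v h) \<bullet> gradient F (A *v x) = h \<bullet> (gradient F (A *v x) v* A)" for h
    by (metis dot_lmul_matrix inner_commute)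
  ultimately have "GDERIV (smooth_part A F) x :> gradient F (A *v x) v* A"
    by (simp add: gderiv_def)
  then show ?thesis
    by (simp add: gradient_eqI dot_lmul_matrix)
qed

lemma partial_gradient_inner:
  assumes "x \<in> X"
  shows "pgrad i x \<bullet> v = gradient F (A *v x) \<bullet> (A *v P i v)"
  by (simp add: partial_gradient_def inner_block_proj_left gradient_smooth_part[OF assms])

text \<open>The supremum in \<open>grad_bound\<close> dominates its members only if they are
  bounded. They are, since a Lipschitz gradient on the bounded image of \<open>X\<close> under
  \<open>A\<close> is bounded.\<close>

lemma norm_partial_gradient_le:
  assumes "i \<in> {1..N}" "x \<in> X"
  shows "norm (pgrad i x) \<le> grad_bound blk N A F g i"
proof -
  have "bounded (gradient F ` (*v) A ` X)"
    using gradF_lipschitz bounded_feasible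
    by (intro bounded_uniformly_continuous_image lipschitz_on_uniformly_continuous
        bounded_linear_image) auto
  then obtain B where B: "norm (gradient F (A *v x)) \<le> B" if "x \<in> X" for x
    by (auto simp: bounded_iff)
  have "norm (pgrad i x) \<le> B * sn i" if x: "x \<in> X" for x
  proof -
    have "P i (pgrad i x) = pgrad i x"
      by (simp add: partial_gradient_def block_proj_block_space[OF block_proj_in_block_space])
    \<comment> \<open>The partial gradient is tested against itself; one factor of its norm cancels
      afterwards.\<close>
    then have "(norm (pgrad i x))\<^sup>2 = gradient F (A *v x) \<bullet> (A *v pgrad i x)"
      by (simp add: power2_norm_eq_inner partial_gradient_inner[OF x])
    also have "\<dots> \<le> norm (gradient F (A *v x)) * norm (A *v pgrad i x)"
      by (rule norm_cauchy_schwarz)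
    also have "\<dots> \<le> B * (sn i * norm (pgrad i x))"
      using B[OF x] by (intro mult_mono norm_mult_block_space_le)
        (auto simp: partial_gradient_def block_proj_in_block_space intro: order_trans[OF norm_ge_zero])
    finally have "norm (pgrad i x) * norm (pgrad i x) \<le> (B * sn i) * norm (pgrad i x)"
      by (simp add: power2_eq_square)
    moreover have "0 \<le> B * sn i"
      using order_trans[OF norm_ge_zero B[OF x]] by (simp add: spectral_norm_nonneg)
    ultimately show ?thesis
      by (cases "norm (pgrad i x) = 0") auto
  qed
  then have "bdd_above ((\<lambda>x. norm (pgrad i x)) ` X)"
    by (auto intro!: bdd_aboveI)
  then show ?thesis
    unfolding grad_bound_def using assms(2) by (intro cSUP_upper)
qed

section \<open>Block measures and their sum\<close>

text \<open>Cauchy-Schwarz bounds the linear term and the Lipschitz constant bounds the change in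
  \<open>g i\<close>, each times the block diameter. The bound also makes the supremum in
  \<open>S\<close> well behaved.\<close>

lemma block_gap_le_K:
  assumes i: "i \<in> {1..N}" and x: "x \<in> X" and q: "q \<in> Xi i"
  shows "pgrad i x \<bullet> (P i x - q) + G i (P i x) - G i q \<le> K i"
proof -
  have Px: "P i x \<in> Xi i" using feasibleD[OF x i] .
  have d: "norm (P i x - q) \<le> D i" using dist_block_dom[OF i Px q] .
  have gb: "norm (pgrad i x) \<le> grad_bound blk N A F g i"
    by (rule norm_partial_gradient_le[OF i x])
  have "pgrad i x \<bullet> (P i x - q) \<le> norm (pgrad i x) * norm (P i x - q)"
    by (rule norm_cauchy_schwarz)
  also have "\<dots> \<le> grad_bound blk N A F g i * D i"
    using d gb by (intro mult_mono) (auto intro: order_trans[OF norm_ge_zero])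
  finally have 1: "pgrad i x \<bullet> (P i x - q) \<le> grad_bound blk N A F g i * D i" .
  have "G i (P i x) - G i q \<le> l i * norm (P i x - q)"
    using lipschitz_onD[OF g_lipschitz[OF i] Px q] by (simp add: dist_norm)
  also have "\<dots> \<le> l i * D i"
    using d lipschitz_on_nonneg[OF g_lipschitz[OF i]] by (intro mult_left_mono)
  finally show ?thesis using 1 by (simp add: K_const_def algebra_simps)
qed

lemma bdd_above_block_gap:
  assumes "i \<in> {1..N}" "x \<in> X"
  shows "bdd_above ((\<lambda>q. pgrad i x \<bullet> (P i x - q) + G i (P i x) - G i q) ` Xi i)"
  using block_gap_le_K[OF assms] by (auto intro!: bdd_aboveI)

lemma S_upper:
  assumes "i \<in> {1..N}" "x \<in> X" "q \<in> Xi i"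
  shows "pgrad i x \<bullet> (P i x - q) + G i (P i x) - G i q \<le> S i x"
  unfolding partial_opt_measure_def
  by (rule cSUP_upper[OF assms(3) bdd_above_block_gap[OF assms(1,2)]])

lemma S_least:
  assumes "i \<in> {1..N}"
    and "\<And>q. q \<in> Xi i \<Longrightarrow> pgrad i x \<bullet> (P i x - q) + G i (P i x) - G i q \<le> c"
  shows "S i x \<le> c"
  unfolding partial_opt_measure_def
  by (rule cSUP_least) (use assms block_dom_nonempty in auto)

lemma S_nonneg: "\<lbrakk>i \<in> {1..N}; x \<in> X\<rbrakk> \<Longrightarrow> 0 \<le> S i x"
  using S_upper[of i x "P i x"] feasibleD by simp

lemma S_le_K: "\<lbrakk>i \<in> {1..N}; x \<in> X\<rbrakk> \<Longrightarrow> S i x \<le> K i"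
  using block_gap_le_K by (blast intro: S_least)

text \<open>The gap and the linearised block objective have sum independent of \<open>q\<close>, so
  a minimiser of the latter attains the supremum of the former.\<close>

lemma S_eq_at_minimiser:
  assumes i: "i \<in> {1..N}" and x: "x \<in> X"
    and min: "is_arg_min (\<lambda>q. ereal (pgrad i x \<bullet> q) + g i q) (\<lambda>q. q \<in> Xi i) p"
  shows "p \<in> Xi i" and "S i x = pgrad i x \<bullet> (P i x - p) + G i (P i x) - G i p"
proof -
  show p: "p \<in> Xi i" using min by (simp add: is_arg_min_def)
  have "S i x \<le> pgrad i x \<bullet> (P i x - p) + G i (P i x) - G i p"
  proof (rule S_least[OF i])
    fix q assume q: "q \<in> Xi i"
    have "ereal (pgrad i x \<bullet> p) + g i p \<le> ereal (pgrad i x \<bullet> q) + g i q"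
      using min q by (simp add: is_arg_min_linorder)
    then have "pgrad i x \<bullet> p + G i p \<le> pgrad i x \<bullet> q + G i q"
      using g_finite[OF i p] g_finite[OF i q] by (metis ereal_less_eq(3) plus_ereal.simps(1))
    then show "pgrad i x \<bullet> (P i x - q) + G i (P i x) - G i q
        \<le> pgrad i x \<bullet> (P i x - p) + G i (P i x) - G i p"
      by (simp add: inner_diff_right)
  qed
  then show "S i x = pgrad i x \<bullet> (P i x - p) + G i (P i x) - G i p"
    using S_upper[OF i x p] by simp
qed

lemma gradient_inner_sum:
  "gradient (smooth_part A F) x \<bullet> v = (\<Sum>i=1..N. pgrad i x \<bullet> P i v)"
proof -
  have "gradient (smooth_part A F) x \<bullet> v = (\<Sum>i=1..N. gradient (smooth_part A F) x \<bullet> P i v)"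
    by (simp only: inner_sum_right[symmetric] sum_block_proj[OF blocks])
  then show ?thesis
    by (simp add: partial_gradient_def inner_block_proj_left
        block_proj_block_space[OF block_proj_in_block_space])
qed

lemma separable_part_finite:
  assumes "x \<in> X"
  shows "separable_part blk N g x = ereal (\<Sum>i=1..N. G i (P i x))"
proof -
  have "separable_part blk N g x = (\<Sum>i=1..N. ereal (G i (P i x)))"
    unfolding separable_part_def
    using g_finite feasibleD[OF assms] by (intro sum.cong) auto
  then show ?thesis by simp
qed

lemma objective_eq_H: "x \<in> X \<Longrightarrow> objective blk N A F g x = ereal (H x)"
  by (simp add: objective_def smooth_part_def H_def separable_part_finite)

lemma objective_infeasible:
  assumes "x \<notin> X"
  shows "objective blk N A F g x = \<infinity>"
proof -
  obtain j where j: "j \<in> {1..N}" "P j x \<notin> Xi j"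
    using assms by (auto simp: feasible_def)
  then have "g j (P j x) = \<infinity>"
    by (simp add: block_dom_def ereal_dom_def block_proj_in_block_space)
  then have "separable_part blk N g x = \<infinity>"
    unfolding separable_part_def using j(1) by (subst sum_Pinfty) auto
  then show ?thesis by (simp add: objective_def)
qed

text \<open>The gap separates over the blocks, and each summand is a candidate in the supremum for
  its own block.\<close>

lemma gap_sum_le:
  assumes "x \<in> X" "q \<in> X"
  shows "gradient (smooth_part A F) x \<bullet> (x - q) + (\<Sum>i=1..N. G i (P i x)) - (\<Sum>i=1..N. G i (P i q))
    \<le> (\<Sum>i=1..N. S i x)"
  unfolding gradient_inner_sum block_proj_diff sum.distrib[symmetric] sum_subtractf[symmetric]
  using S_upper assms feasibleD by (intro sum_mono) auto

lemma opt_measure_le_sum: "x \<in> X \<Longrightarrow> opt_measure blk N A F g x \<le> (\<Sum>i=1..N. S i x)"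
  unfolding opt_measure_def
  by (rule cSUP_least) (use gap_sum_le in \<open>auto simp: separable_part_finite\<close>)

lemma H_gap_le_sum:
  assumes x: "x \<in> X" and q: "q \<in> X"
  shows "H x - H q \<le> (\<Sum>i=1..N. S i x)"
proof -
  have "F (A *v x) + gradient F (A *v x) \<bullet> (A *v q - A *v x) \<le> F (A *v q)"
    using x q F_differentiable by (intro convex_on_gradient_inequality[OF F_convex]) auto
  then have "F (A *v x) - F (A *v q) \<le> gradient (smooth_part A F) x \<bullet> (x - q)"
    by (simp add: gradient_smooth_part[OF x] matrix_vector_mult_diff_distrib inner_diff_right)
  then show ?thesis
    using gap_sum_le[OF x q] by (simp add: H_def)
qed

text \<open>Real counterpart of \<open>optimal_value\<close>, which is an infimum over the whole
  space in the extended reals.\<close>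

definition "Hmin = (INF q\<in>X. H q)"

text \<open>The gap bound at a single feasible point already bounds \<open>H\<close> from below on
  all of \<open>X\<close>.\<close>

lemma bdd_below_H: "bdd_below (H ` X)"
proof (cases "X = {}")
  case False
  then obtain x where x: "x \<in> X" by blast
  have "H x - (\<Sum>i=1..N. S i x) \<le> H q" if "q \<in> X" for q
    using H_gap_le_sum[OF x that] by simp
  then show ?thesis by (auto intro!: bdd_belowI)
qed simp

lemma Hmin_le: "x \<in> X \<Longrightarrow> Hmin \<le> H x"
  unfolding Hmin_def using bdd_below_H by (intro cINF_lower)

lemma H_minus_Hmin_le_sum:
  assumes "x \<in> X"
  shows "H x - Hmin \<le> (\<Sum>i=1..N. S i x)"
proof -
  have "H x - (\<Sum>i=1..N. S i x) \<le> Hmin"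
    unfolding Hmin_def using assms H_gap_le_sum[OF assms]
    by (intro cINF_greatest) (auto simp: diff_le_eq add.commute)
  then show ?thesis by simp
qed

lemma Hmin_le_optimal_value: "ereal Hmin \<le> optimal_value blk N A F g"
  unfolding optimal_value_def
proof (rule INF_greatest)
  fix x
  show "ereal Hmin \<le> objective blk N A F g x"
    by (cases "x \<in> X") (simp_all add: objective_eq_H objective_infeasible Hmin_le)
qed

section \<open>One block: perturbation and descent\<close>

text \<open>Equal i-th blocks make the \<open>g i\<close> terms and the directions agree, so only
  the gradient changes. The change is measured through \<open>A\<close>, the quantity that block
  steps control.\<close>

lemma S_gradient_perturbation:
  assumes i: "i \<in> {1..N}" and x: "x \<in> X" and y: "y \<in> X" and eq: "P i y = P i x"
  shows "S i x \<le> S i y + LF * norm (A *v (y - x)) * sn i * D i"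
proof (rule S_least[OF i])
  fix q assume q: "q \<in> Xi i"
  have sp: "P i x - q \<in> block_space blk i"
    by (rule diff_block_proj_in_block_space(2)[OF q])
  have "pgrad i x \<bullet> (P i x - q) - pgrad i y \<bullet> (P i x - q)
      = (gradient F (A *v x) - gradient F (A *v y)) \<bullet> (A *v (P i x - q))"
    by (simp add: partial_gradient_inner x y block_proj_block_space[OF sp] inner_diff_left)
  also have "\<dots> \<le> norm (gradient F (A *v x) - gradient F (A *v y)) * norm (A *v (P i x - q))"
    by (rule norm_cauchy_schwarz)
  also have "\<dots> \<le> (LF * norm (A *v (y - x))) * (sn i * D i)"
  proof (intro mult_mono)
    show "norm (gradient F (A *v x) - gradient F (A *v y)) \<le> LF * norm (A *v (y - x))"
      using lipschitz_onD[OF gradF_lipschitz, of "A *v x" "A *v y"] x y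
      by (simp add: dist_norm matrix_vector_mult_diff_distrib norm_minus_commute)
    have "norm (A *v (P i x - q)) \<le> sn i * norm (P i x - q)"
      by (rule norm_mult_block_space_le[OF sp])
    also have "\<dots> \<le> sn i * D i"
      using dist_block_dom[OF i feasibleD[OF x i] q] by (intro mult_left_mono spectral_norm_nonneg)
    finally show "norm (A *v (P i x - q)) \<le> sn i * D i" .
  qed (use lipschitz_on_nonneg[OF gradF_lipschitz] in auto)
  finally show "pgrad i x \<bullet> (P i x - q) + G i (P i x) - G i q
      \<le> S i y + LF * norm (A *v (y - x)) * sn i * D i"
    using S_upper[OF i y q] by (simp add: eq mult_ac)
qed

lemma feasible_block_update:
  assumes i: "i \<in> {1..N}" and y: "y \<in> X" and q: "q \<in> Xi i" and t: "0 \<le> t" "t \<le> 1"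
  shows "P i (y + t *\<^sub>R (q - P i y)) = (1 - t) *\<^sub>R P i y + t *\<^sub>R q"
    and "j \<noteq> i \<Longrightarrow> P j (y + t *\<^sub>R (q - P i y)) = P j y"
    and "y + t *\<^sub>R (q - P i y) \<in> X"
proof -
  have sp: "q - P i y \<in> block_space blk i"
    by (rule diff_block_proj_in_block_space(1)[OF q])
  have proj: "P j (y + t *\<^sub>R (q - P i y)) = (if j = i then (1 - t) *\<^sub>R P i y + t *\<^sub>R q else P j y)" for j
  proof -
    have "(1 - t) *\<^sub>R P i y + t *\<^sub>R q = P i y + t *\<^sub>R (q - P i y)"
      by (simp add: algebra_simps)
    then show ?thesis
      by (simp add: block_proj_add block_proj_scaleR block_proj_block_space[OF sp])
  qed
  then show "P i (y + t *\<^sub>R (q - P i y)) = (1 - t) *\<^sub>R P i y + t *\<^sub>R q"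
    and "j \<noteq> i \<Longrightarrow> P j (y + t *\<^sub>R (q - P i y)) = P j y"
    by auto
  have "(1 - t) *\<^sub>R P i y + t *\<^sub>R q \<in> Xi i"
    using convex_fun_on_segment(1)[OF g_convex[OF i] g_proper[OF i] _ _ t] feasibleD[OF y i] q
    by (simp add: block_dom_def)
  then show "y + t *\<^sub>R (q - P i y) \<in> X"
    using y unfolding feasible_def by (auto simp: proj)
qed

text \<open>The segment estimate for \<open>F\<close> is added to convexity of \<open>g i\<close>;
  as \<open>q\<close> is the minimiser, the first-order terms combine to exactly
  \<open>- t * S i y\<close>. The curvature \<open>L\<close> is left free so that a trial value of
  the backtracking can be inserted.\<close>

lemma block_descent:
  assumes i: "i \<in> {1..N}" and y: "y \<in> X"
    and min: "is_arg_min (\<lambda>q. ereal (pgrad i y \<bullet> q) + g i q) (\<lambda>q. q \<in> Xi i) q"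
    and t: "0 \<le> t" "t \<le> 1"
    and lip: "\<And>h. \<lbrakk>h \<in> block_space blk i; y + h \<in> X\<rbrakk> \<Longrightarrow>
        norm (gradient F (A *v y + A *v h) - gradient F (A *v y)) \<le> L * norm (A *v h)"
  shows "H (y + t *\<^sub>R (q - P i y)) \<le> H y - t * S i y + L / 2 * t\<^sup>2 * (norm (A *v (q - P i y)))\<^sup>2"
proof -
  note q = S_eq_at_minimiser[OF i y min]
  let ?d = "q - P i y"
  have sp: "?d \<in> block_space blk i"
    by (rule diff_block_proj_in_block_space(1)[OF q(1)])
  have sp': "P i y - q \<in> block_space blk i"
    by (rule diff_block_proj_in_block_space(2)[OF q(1)])
  have A: "A *v (y + s *\<^sub>R ?d) = A *v y + s *\<^sub>R (A *v ?d)" for s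
    by (simp add: matrix_vector_right_distrib matrix_vector_mult_scaleR)
  have "F (A *v y + t *\<^sub>R (A *v ?d))
      \<le> F (A *v y) + t * (gradient F (A *v y) \<bullet> (A *v ?d)) + L / 2 * t\<^sup>2 * (norm (A *v ?d))\<^sup>2"
  proof (rule descent_along_segment[OF t])
    fix s :: real assume s: "0 \<le> s" "s \<le> 1"
    have fs: "y + s *\<^sub>R ?d \<in> X" by (rule feasible_block_update(3)[OF i y q(1) s])
    show "F differentiable (at (A *v y + s *\<^sub>R (A *v ?d)))"
      using F_differentiable[OF fs] by (simp add: A)
    show "norm (gradient F (A *v y + s *\<^sub>R (A *v ?d)) - gradient F (A *v y)) \<le> L * norm (s *\<^sub>R (A *v ?d))"
      using lip[of "s *\<^sub>R ?d"] fs sp by (simp add: matrix_vector_mult_scaleR block_space_def)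
  qed
  moreover have grad: "gradient F (A *v y) \<bullet> (A *v ?d) = - (pgrad i y \<bullet> (P i y - q))"
    unfolding partial_gradient_inner[OF y] block_proj_block_space[OF sp']
    by (simp add: matrix_vector_mult_diff_distrib inner_diff_right)
  moreover have "(\<Sum>j=1..N. G j (P j (y + t *\<^sub>R ?d))) \<le> (\<Sum>j=1..N. G j (P j y)) + t * (G i q - G i (P i y))"
  proof -
    have "G i (P i (y + t *\<^sub>R ?d)) \<le> (1 - t) * G i (P i y) + t * G i q"
      unfolding feasible_block_update(1)[OF i y q(1) t]
      using convex_fun_on_segment(2)[OF g_convex[OF i] g_proper[OF i] _ _ t] feasibleD[OF y i] q(1)
      by (simp add: block_dom_def)
    moreover have "(\<Sum>j\<in>{1..N} - {i}. G j (P j (y + t *\<^sub>R ?d))) = (\<Sum>j\<in>{1..N} - {i}. G j (P j y))"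
      by (intro sum.cong) (auto simp: feasible_block_update(2)[OF i y q(1) t])
    ultimately show ?thesis
      using i by (simp add: sum.remove[of _ i] algebra_simps)
  qed
  ultimately show ?thesis
    unfolding H_def A q(2) grad by (simp add: algebra_simps)
qed

end

section \<open>The backtracking method\<close>

locale cbcg_b_run = block_composite_problem blk N A F g l LF
  for blk :: "'d::finite \<Rightarrow> nat" and N :: nat
    and A :: "real^'d^'m::finite" and F :: "real^'m \<Rightarrow> real"
    and g :: "nat \<Rightarrow> real^'d \<Rightarrow> ereal"
    and l :: "nat \<Rightarrow> real" and LF :: real +
  fixes \<beta> :: "nat \<Rightarrow> real" and \<beta>init \<kappa> :: real
    and x p :: "nat \<Rightarrow> nat \<Rightarrow> real^'d" and \<xi> :: "nat \<Rightarrow> nat \<Rightarrow> int"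
  assumes beta: "\<And>i y h. \<lbrakk>i \<in> {1..N}; y \<in> X; h \<in> block_space blk i; y + h \<in> X\<rbrakk> \<Longrightarrow>
          norm (gradient F (A *v y + block_cols blk i A *v h) - gradient F (A *v y))
            \<le> \<beta> i * norm (block_cols blk i A *v h)"
    and beta_init: "\<beta>init > 0" and kappa: "\<kappa> > 1"
    and iterates: "cbcg_b_sequence blk N A F g \<beta>init \<kappa> x p \<xi>"
begin

abbreviation "step i y q z \<equiv> cbcg_stepsize blk A F g \<beta>init \<kappa> i y q z"
abbreviation "\<xi>prev k i \<equiv> (if k = 0 then 0 else \<xi> (k - 1) i)"
abbreviation "\<alpha> k i \<equiv> step i (x k (i - 1)) (p k i) (\<xi> k i)"
abbreviation "moved k i \<equiv> A *v (x k i - x k (i - 1))"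

definition "Cmax = (MAX i\<in>{1..N}. max (max (\<kappa> * \<beta> i) \<beta>init * (sn i)\<^sup>2 * (D i)\<^sup>2) (K i))"
definition "snmax = (MAX i\<in>{1..N}. (sn i)\<^sup>2)"

section \<open>Unpacking a run of the method\<close>

lemma x_start: "x 0 0 \<in> X"
  using iterates by (simp add: cbcg_b_sequence_def)

lemma x_next: "x (Suc k) 0 = x k N"
  using iterates by (simp add: cbcg_b_sequence_def)

lemma
  assumes "i \<in> {1..N}"
  shows p_minimiser:
      "is_arg_min (\<lambda>q. ereal (pgrad i (x k (i - 1)) \<bullet> q) + g i q) (\<lambda>q. q \<in> Xi i) (p k i)"
    and \<xi>_least: "is_arg_min id (\<lambda>z. \<xi>prev k i \<le> z \<and>
        cbcg_sufficient_decrease blk N A F g i (x k (i - 1)) (p k i) (step i (x k (i - 1)) (p k i) z)) (\<xi> k i)"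
    and x_update: "x k i = x k (i - 1) + \<alpha> k i *\<^sub>R (p k i - P i (x k (i - 1)))"
  using iterates assms unfolding cbcg_b_sequence_def Let_def by blast+

lemma \<xi>_ge_prev: "i \<in> {1..N} \<Longrightarrow> \<xi>prev k i \<le> \<xi> k i"
  using \<xi>_least unfolding is_arg_min_linorder by blast

lemma \<xi>_nonneg: "i \<in> {1..N} \<Longrightarrow> 0 \<le> \<xi> k i"
proof (induction k)
  case 0
  then show ?case using \<xi>_ge_prev[of i 0] by simp
next
  case (Suc k)
  then show ?case using \<xi>_ge_prev[of i "Suc k"] by simp
qed

section \<open>Step sizes and backtracked curvature\<close>

text \<open>The last bound has two cases: a full step uses \<open>S i y \<le> K i\<close>, whereas a
  step below 1 equals \<open>S i y / c\<close>. A zero denominator falls under the full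
  step.\<close>

lemma step_bounds:
  fixes q z
  assumes i: "i \<in> {1..N}" and y: "y \<in> X"
  defines "c \<equiv> \<kappa> powi z * \<beta>init * (norm (A *v (q - P i y)))\<^sup>2"
  assumes q: "q \<in> Xi i"
  shows "0 \<le> step i y q z" and "step i y q z \<le> 1"
    and "step i y q z * c \<le> S i y"
    and "\<lbrakk>c \<le> C; K i \<le> C\<rbrakk> \<Longrightarrow> S i y \<le> C * step i y q z"
proof -
  have "q - P i y \<in> block_space blk i"
    by (rule diff_block_proj_in_block_space(1)[OF q])
  then have st: "step i y q z = (if c = 0 then 1 else min (S i y / c) 1)"
    by (simp add: cbcg_stepsize_def c_def block_cols_mult block_proj_block_space)
  have c: "0 \<le> c" using beta_init kappa by (simp add: c_def)
  have S: "0 \<le> S i y" by (rule S_nonneg[OF i y])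
  show "0 \<le> step i y q z" "step i y q z \<le> 1"
    using c S by (auto simp: st)
  show "step i y q z * c \<le> S i y"
    using c S by (auto simp: st min_def field_simps)
  assume C: "c \<le> C" "K i \<le> C"
  show "S i y \<le> C * step i y q z"
  proof (cases "step i y q z = 1")
    case True
    then show ?thesis using S_le_K[OF i y] C by simp
  next
    case False
    then have "c \<noteq> 0" "step i y q z = S i y / c"
      by (auto simp: st min_def split: if_splits)
    then have "S i y = c * step i y q z" by simp
    also have "\<dots> \<le> C * step i y q z"
      using C \<open>0 \<le> step i y q z\<close> by (intro mult_right_mono)
    finally show ?thesis .
  qed
qed

lemma sufficient_decrease_iff:
  assumes i: "i \<in> {1..N}" and y: "y \<in> X" and q: "q \<in> Xi i" and t: "0 \<le> t" "t \<le> 1"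
  shows "cbcg_sufficient_decrease blk N A F g i y q t \<longleftrightarrow>
    t / 2 * S i y \<le> H y - H (y + t *\<^sub>R (q - P i y))"
  unfolding cbcg_sufficient_decrease_def
  by (simp add: objective_eq_H[OF y] objective_eq_H[OF feasible_block_update(3)[OF i y q t]])

text \<open>Once the trial curvature reaches \<open>\<beta> i\<close>, the descent estimate applies
  with it. The choice of step then lets the quadratic term consume at most half of the linear
  decrease.\<close>

lemma sufficient_decrease_if_large:
  assumes i: "i \<in> {1..N}" and y: "y \<in> X"
    and min: "is_arg_min (\<lambda>q. ereal (pgrad i y \<bullet> q) + g i q) (\<lambda>q. q \<in> Xi i) q"
    and large: "\<beta> i \<le> \<kappa> powi z * \<beta>init"
  shows "cbcg_sufficient_decrease blk N A F g i y q (step i y q z)"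
proof -
  note q = S_eq_at_minimiser(1)[OF i y min]
  define t where "t = step i y q z"
  define n where "n = (norm (A *v (q - P i y)))\<^sup>2"
  have t: "0 \<le> t" "t \<le> 1" "t * (\<kappa> powi z * \<beta>init * n) \<le> S i y"
    unfolding t_def n_def using step_bounds[OF i y q] by auto
  have "H (y + t *\<^sub>R (q - P i y)) \<le> H y - t * S i y + (\<kappa> powi z * \<beta>init) / 2 * t\<^sup>2 * n"
    unfolding n_def
  proof (rule block_descent[OF i y min t(1,2)])
    fix h assume h: "h \<in> block_space blk i" "y + h \<in> X"
    have "norm (gradient F (A *v y + A *v h) - gradient F (A *v y)) \<le> \<beta> i * norm (A *v h)"
      using beta[OF i y h] h by (simp add: block_cols_mult block_proj_block_space)
    also have "\<dots> \<le> \<kappa> powi z * \<beta>init * norm (A *v h)"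
      using large by (intro mult_right_mono) auto
    finally show "norm (gradient F (A *v y + A *v h) - gradient F (A *v y))
        \<le> \<kappa> powi z * \<beta>init * norm (A *v h)" .
  qed
  moreover have "(\<kappa> powi z * \<beta>init) / 2 * t\<^sup>2 * n \<le> t / 2 * S i y"
    using mult_left_mono[OF t(3), of "t / 2"] t(1) by (simp add: power2_eq_square mult_ac)
  ultimately show ?thesis
    using sufficient_decrease_iff[OF i y q t(1,2)] by (simp add: t_def)
qed

lemma feasible_step:
  assumes i: "i \<in> {1..N}" and y: "x k (i - 1) \<in> X"
  shows "x k i \<in> X"
proof -
  note q = S_eq_at_minimiser(1)[OF i y p_minimiser[OF i]]
  show ?thesis
    unfolding x_update[OF i, of k]
    by (rule feasible_block_update(3)[OF i y q step_bounds(1,2)[OF i y q]])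
qed

lemma feasible_iterates: "i \<le> N \<Longrightarrow> x k i \<in> X"
proof -
  have inner: "x k i \<in> X" if "x k 0 \<in> X" "i \<le> N" for k i
    using that(2)
  proof (induction i)
    case (Suc i)
    then show ?case using feasible_step[of "Suc i" k] by simp
  qed (rule that(1))
  have "x k 0 \<in> X"
    by (induction k) (simp_all add: x_start x_next inner)
  then show "i \<le> N \<Longrightarrow> x k i \<in> X" by (rule inner)
qed

lemma feasible_prev: "i \<in> {1..N} \<Longrightarrow> x k (i - 1) \<in> X"
  by (rule feasible_iterates) auto

lemma p_in_block_dom: "i \<in> {1..N} \<Longrightarrow> p k i \<in> Xi i"
  using S_eq_at_minimiser(1)[OF _ feasible_prev p_minimiser] by blast

text \<open>If the accepted curvature exceeds \<open>\<kappa> * \<beta> i\<close>, the exponent one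
  lower would pass the test as well. Minimality then allows no increase over the previous
  exponent.\<close>

lemma \<beta>_step:
  assumes i: "i \<in> {1..N}"
  shows "\<xi> k i = \<xi>prev k i \<or> \<kappa> powi (\<xi> k i) * \<beta>init \<le> \<kappa> * \<beta> i"
proof (rule disjCI)
  assume "\<not> \<kappa> powi (\<xi> k i) * \<beta>init \<le> \<kappa> * \<beta> i"
  moreover have "\<kappa> powi (\<xi> k i) = \<kappa> * \<kappa> powi (\<xi> k i - 1)"
    using power_int_add_1[of \<kappa> "\<xi> k i - 1"] kappa by simp
  ultimately have "\<beta> i \<le> \<kappa> powi (\<xi> k i - 1) * \<beta>init"
    using kappa by (simp add: mult.assoc)
  then have "cbcg_sufficient_decrease blk N A F g i (x k (i - 1)) (p k i)
      (step i (x k (i - 1)) (p k i) (\<xi> k i - 1))"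
    by (rule sufficient_decrease_if_large[OF i feasible_prev[OF i] p_minimiser[OF i]])
  then have "\<not> \<xi>prev k i \<le> \<xi> k i - 1"
    using \<xi>_least[OF i, of k] unfolding is_arg_min_linorder by fastforce
  then show "\<xi> k i = \<xi>prev k i"
    using \<xi>_ge_prev[OF i, of k] by linarith
qed

text \<open>Exponents start from 0 and never decrease, which gives the lower bound. For the upper
  one, each cycle either inherits the previous curvature or ends below
  \<open>\<kappa> * \<beta> i\<close>.\<close>

lemma \<beta>_bounds:
  assumes "i \<in> {1..N}"
  shows "\<beta>init \<le> \<kappa> powi (\<xi> k i) * \<beta>init"
    and "\<kappa> powi (\<xi> k i) * \<beta>init \<le> max (\<kappa> * \<beta> i) \<beta>init"
proof -
  have "1 \<le> \<kappa> powi (\<xi> k i)"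
    using kappa \<xi>_nonneg[OF assms, of k] by (simp add: power_int_def one_le_power)
  then show "\<beta>init \<le> \<kappa> powi (\<xi> k i) * \<beta>init"
    using beta_init by simp
  show "\<kappa> powi (\<xi> k i) * \<beta>init \<le> max (\<kappa> * \<beta> i) \<beta>init"
  proof (induction k)
    case 0
    show ?case using \<beta>_step[OF assms, of 0] by (auto simp: max_def)
  next
    case (Suc k)
    then show ?case using \<beta>_step[OF assms, of "Suc k"] by (auto simp: max_def)
  qed
qed

section \<open>Decrease in one block step\<close>

lemma H_decrease:
  assumes i: "i \<in> {1..N}"
  shows "\<alpha> k i / 2 * S i (x k (i - 1)) \<le> H (x k (i - 1)) - H (x k i)"
proof -
  note y = feasible_prev[OF i, of k] and q = p_in_block_dom[OF i, of k]
  note b = step_bounds(1,2)[OF i y q, of "\<xi> k i"]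
  show ?thesis
    using \<xi>_least[OF i, of k] sufficient_decrease_iff[OF i y q b]
    unfolding is_arg_min_linorder x_update[OF i, of k, symmetric] by blast
qed

text \<open>The upper curvature bound gives \<open>S \<le> Cmax * \<alpha>\<close>; multiplying by
  \<open>S\<close> produces the product \<open>\<alpha> * S\<close> that the acceptance test
  controls.\<close>

lemma S_squared_le_decrease:
  assumes i: "i \<in> {1..N}"
  shows "(S i (x k (i - 1)))\<^sup>2 \<le> 2 * Cmax * (H (x k (i - 1)) - H (x k i))"
proof -
  let ?y = "x k (i - 1)" and ?q = "p k i"
  note y = feasible_prev[OF i, of k] and q = p_in_block_dom[OF i, of k]
  have C: "max (max (\<kappa> * \<beta> i) \<beta>init * (sn i)\<^sup>2 * (D i)\<^sup>2) (K i) \<le> Cmax"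
    unfolding Cmax_def using i by (intro Max_ge) auto
  have "?q - P i ?y \<in> block_space blk i"
    by (rule diff_block_proj_in_block_space(1)[OF q])
  then have "norm (A *v (?q - P i ?y)) \<le> sn i * norm (?q - P i ?y)"
    by (rule norm_mult_block_space_le)
  also have "\<dots> \<le> sn i * D i"
    using dist_block_dom[OF i q feasibleD[OF y i]] by (intro mult_left_mono spectral_norm_nonneg)
  finally have "(norm (A *v (?q - P i ?y)))\<^sup>2 \<le> (sn i * D i)\<^sup>2"
    by (intro power_mono) auto
  then have "\<kappa> powi (\<xi> k i) * \<beta>init * (norm (A *v (?q - P i ?y)))\<^sup>2
      \<le> max (\<kappa> * \<beta> i) \<beta>init * (sn i * D i)\<^sup>2"
    using \<beta>_bounds[OF i, of k] beta_init by (intro mult_mono) auto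
  also have "\<dots> \<le> Cmax" using C by (simp add: power_mult_distrib mult_ac)
  finally have "S i ?y \<le> Cmax * \<alpha> k i"
    using C by (intro step_bounds(4)[OF i y q]) auto
  moreover have "0 \<le> S i ?y" by (rule S_nonneg[OF i y])
  ultimately have "S i ?y * S i ?y \<le> (Cmax * \<alpha> k i) * S i ?y"
    by (rule mult_right_mono)
  also have "\<dots> = 2 * Cmax * (\<alpha> k i / 2 * S i ?y)" by simp
  also have "\<dots> \<le> 2 * Cmax * (H ?y - H (x k i))"
    \<comment> \<open>\<open>Cmax\<close> is nonnegative because
      \<open>0 \<le> S \<le> K \<le> Cmax\<close>.\<close>
    using H_decrease[OF i, of k] C S_le_K[OF i y] \<open>0 \<le> S i ?y\<close> by (intro mult_left_mono) auto
  finally show ?thesis by (simp add: power2_eq_square)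
qed

text \<open>Here the lower curvature bound enters: replacing \<open>\<beta>init\<close> by the
  accepted curvature lets the step rule bound the squared displacement by
  \<open>\<alpha> * S\<close>, up to the factor \<open>\<beta>init\<close>.\<close>

lemma moved_squared_le_decrease:
  assumes i: "i \<in> {1..N}"
  shows "(norm (moved k i))\<^sup>2 \<le> 2 / \<beta>init * (H (x k (i - 1)) - H (x k i))"
proof -
  let ?y = "x k (i - 1)" and ?n = "(norm (A *v (p k i - P i (x k (i - 1)))))\<^sup>2"
  note y = feasible_prev[OF i, of k] and q = p_in_block_dom[OF i, of k]
  note b = step_bounds(1,3)[OF i y q, of "\<xi> k i"]
  have "x k i - ?y = \<alpha> k i *\<^sub>R (p k i - P i ?y)"
    using x_update[OF i, of k] by simp
  then have "moved k i = \<alpha> k i *\<^sub>R (A *v (p k i - P i ?y))"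
    by (simp only: matrix_vector_mult_scaleR)
  then have "\<beta>init * (norm (moved k i))\<^sup>2 = \<alpha> k i * (\<alpha> k i * (\<beta>init * ?n))"
    by (simp add: power_mult_distrib power2_eq_square mult_ac)
  also have "\<dots> \<le> \<alpha> k i * (\<alpha> k i * (\<kappa> powi (\<xi> k i) * \<beta>init * ?n))"
    using \<beta>_bounds(1)[OF i, of k] b(1) by (intro mult_left_mono mult_right_mono) auto
  also have "\<dots> \<le> \<alpha> k i * S i ?y"
    using b by (intro mult_left_mono)
  also have "\<dots> \<le> 2 * (H ?y - H (x k i))"
    using H_decrease[OF i, of k] by simp
  finally show ?thesis using beta_init by (simp add: field_simps)
qed

text \<open>Blocks are updated in order, so block \<open>i\<close> is untouched before its turn;
  this is what \<open>S_gradient_perturbation\<close> requires.\<close>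

lemma P_prev_eq:
  assumes "i \<in> {1..N}" "j < i"
  shows "P i (x k j) = P i (x k 0)"
  using assms(2)
proof (induction j)
  case (Suc j)
  then have j: "Suc j \<in> {1..N}" "i \<noteq> Suc j" using assms(1) by auto
  have "P i (x k (Suc j)) = P i (x k j)"
    using x_update[OF j(1), of k] feasible_block_update(2)[OF j(1) feasible_prev[OF j(1)] p_in_block_dom[OF j(1)]
        step_bounds(1,2)[OF j(1) feasible_prev[OF j(1)] p_in_block_dom[OF j(1)]] j(2)] by simp
  then show ?case using Suc by simp
qed simp

section \<open>Assembling a full cycle\<close>

lemma sum_H_decrease: "(\<Sum>i=1..N. H (x k (i - 1)) - H (x k i)) = H (x k 0) - H (x (Suc k) 0)"
  using sum_telescope''[of 0 N "\<lambda>i. - H (x k i)"] by (simp add: x_next)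

lemma drift_squared_le:
  assumes "i \<le> N"
  shows "(norm (A *v (x k i - x k 0)))\<^sup>2 \<le> 2 * real N / \<beta>init * (H (x k 0) - H (x (Suc k) 0))"
proof -
  have "norm (A *v (x k i - x k 0)) \<le> (\<Sum>j=1..i. norm (moved k j))"
  proof (induction i)
    case (Suc i)
    have "A *v (x k (Suc i) - x k 0) = moved k (Suc i) + A *v (x k i - x k 0)"
      by (simp add: matrix_vector_mult_diff_distrib)
    then show ?case
      using Suc norm_triangle_ineq[of "moved k (Suc i)" "A *v (x k i - x k 0)"] by simp
  qed simp
  then have "(norm (A *v (x k i - x k 0)))\<^sup>2 \<le> (\<Sum>j=1..i. norm (moved k j))\<^sup>2"
    by (intro power_mono) auto
  also have "\<dots> \<le> (\<Sum>j=1..i. (norm (moved k j))\<^sup>2) * real i"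
    using sum_squared_le_sum_of_squares[of "\<lambda>j. norm (moved k j)" "{1..i}"] by simp
  \<comment> \<open>Extending the sum to the whole cycle makes the bound uniform in \<open>i\<close>
    and lets the decreases telescope.\<close>
  also have "\<dots> \<le> (\<Sum>j=1..N. (norm (moved k j))\<^sup>2) * real N"
    using assms by (intro mult_mono sum_mono2 sum_nonneg) auto
  also have "\<dots> \<le> (\<Sum>j=1..N. 2 / \<beta>init * (H (x k (j - 1)) - H (x k j))) * real N"
    by (intro mult_right_mono sum_mono moved_squared_le_decrease) auto
  also have "\<dots> = 2 * real N / \<beta>init * (H (x k 0) - H (x (Suc k) 0))"
    unfolding sum_distrib_left[symmetric] sum_H_decrease by simp
  finally show ?thesis .
qed

lemma sn_squared_le: "i \<in> {1..N} \<Longrightarrow> (sn i)\<^sup>2 \<le> snmax"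
  unfolding snmax_def by (intro Max_ge) auto

lemma snmax_nonneg: "0 \<le> snmax"
  using sn_squared_le[of 1] N_pos by (meson atLeastAtMost_iff order_refl order_trans zero_le_power2)

lemma C3_eq:
  "C3_const blk N A F g l LF \<beta> \<beta>init \<kappa> = 4 * (Cmax + real N * LF\<^sup>2 * (diameter X)\<^sup>2 * snmax / \<beta>init)"
  by (simp add: C3_const_def Cmax_def snmax_def)

lemma sum_S_squared_le_decrease:
  "(\<Sum>i=1..N. S i (x k 0))\<^sup>2
    \<le> real N * C3_const blk N A F g l LF \<beta> \<beta>init \<kappa> * (H (x k 0) - H (x (Suc k) 0))"
proof -
  define \<Delta> where "\<Delta> = H (x k 0) - H (x (Suc k) 0)"
  \<comment> \<open>Twice the drift bound times \<open>LF^2 * snmax\<close>; the 2 comes from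
    \<open>(s + e)^2 \<le> 2 s^2 + 2 e^2\<close>.\<close>
  define c where "c = 4 * real N / \<beta>init * \<Delta> * LF\<^sup>2 * snmax"
  \<comment> \<open>The drift bound at \<open>i = 0\<close> has a nonnegative left side, which
    settles the sign.\<close>
  have \<Delta>: "0 \<le> \<Delta>"
    using order_trans[OF zero_le_power2 drift_squared_le[of 0 k]] beta_init N_pos
    by (simp add: \<Delta>_def zero_le_mult_iff zero_le_divide_iff)
  have c: "0 \<le> c" using \<Delta> beta_init snmax_nonneg by (simp add: c_def)
  have each: "(S i (x k 0))\<^sup>2 \<le> 4 * Cmax * (H (x k (i - 1)) - H (x k i)) + c * (D i)\<^sup>2"
    if i: "i \<in> {1..N}" for i
  proof -
    let ?y = "x k (i - 1)"
    let ?e = "LF * norm (A *v (?y - x k 0)) * sn i * D i"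
    have "S i (x k 0) \<le> S i ?y + ?e"
      using i by (intro S_gradient_perturbation[OF i] feasible_iterates P_prev_eq) auto
    then have "(S i (x k 0))\<^sup>2 \<le> (S i ?y + ?e)\<^sup>2"
      by (intro power_mono S_nonneg[OF i] feasible_iterates) auto
    also have "\<dots> \<le> 2 * (S i ?y)\<^sup>2 + 2 * ?e\<^sup>2"
      using sum_squares_bound[of "S i ?y" ?e] by (simp add: power2_sum)
    also have "?e\<^sup>2 = (norm (A *v (?y - x k 0)))\<^sup>2 * (LF\<^sup>2 * (sn i)\<^sup>2 * (D i)\<^sup>2)"
      by (simp add: power_mult_distrib mult_ac)
    also have "\<dots> \<le> (2 * real N / \<beta>init * \<Delta>) * (LF\<^sup>2 * snmax * (D i)\<^sup>2)"
      unfolding \<Delta>_def using i sn_squared_le[OF i]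
      by (intro mult_mono drift_squared_le) (use \<Delta> beta_init snmax_nonneg in \<open>auto simp: \<Delta>_def\<close>)
    finally show ?thesis
      using S_squared_le_decrease[OF i, of k] by (simp add: c_def mult_ac)
  qed
  have "(\<Sum>i=1..N. S i (x k 0))\<^sup>2 \<le> (\<Sum>i=1..N. (S i (x k 0))\<^sup>2) * real N"
    using sum_squared_le_sum_of_squares[of "\<lambda>i. S i (x k 0)" "{1..N}"] by simp
  also have "\<dots> \<le> (\<Sum>i=1..N. 4 * Cmax * (H (x k (i - 1)) - H (x k i)) + c * (D i)\<^sup>2) * real N"
    by (intro mult_right_mono sum_mono each) auto
  \<comment> \<open>The \<open>Cmax\<close> terms telescope over the cycle, while the drift terms
    leave the sum of squared block diameters.\<close>
  also have "\<dots> = (4 * Cmax * \<Delta> + c * (\<Sum>i=1..N. (D i)\<^sup>2)) * real N"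
    unfolding sum.distrib sum_distrib_left[symmetric] sum_H_decrease \<Delta>_def ..
  also have "\<dots> \<le> (4 * Cmax * \<Delta> + c * (diameter X)\<^sup>2) * real N"
    using c by (intro mult_right_mono add_left_mono mult_left_mono sum_squared_diameter) auto
  also have "\<dots> = real N * C3_const blk N A F g l LF \<beta> \<beta>init \<kappa> * \<Delta>"
    by (simp add: C3_eq c_def algebra_simps)
  finally show ?thesis by (simp add: \<Delta>_def)
qed

text \<open>Base case of the recursion, and the source of the 4 in the denominators: every block
  measure is at most \<open>K i\<close>, one of the quantities under the maximum in
  \<open>Cmax\<close>.\<close>

lemma initial_gap: "H (x 0 0) - Hmin \<le> real N * C3_const blk N A F g l LF \<beta> \<beta>init \<kappa> / 4"
proof -
  have "H (x 0 0) - Hmin \<le> (\<Sum>i=1..N. S i (x 0 0))"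
    by (rule H_minus_Hmin_le_sum[OF x_start])
  also have "\<dots> \<le> (\<Sum>i=1..N. Cmax)"
  proof (rule sum_mono)
    fix i assume i: "i \<in> {1..N}"
    have "max (max (\<kappa> * \<beta> i) \<beta>init * (sn i)\<^sup>2 * (D i)\<^sup>2) (K i) \<le> Cmax"
      unfolding Cmax_def using i by (intro Max_ge) auto
    then show "S i (x 0 0) \<le> Cmax" using S_le_K[OF i x_start] by simp
  qed
  also have "\<dots> \<le> real N * (Cmax + real N * LF\<^sup>2 * (diameter X)\<^sup>2 * snmax / \<beta>init)"
    using snmax_nonneg beta_init by (simp add: mult_left_mono)
  also have "Cmax + real N * LF\<^sup>2 * (diameter X)\<^sup>2 * snmax / \<beta>init
      = C3_const blk N A F g l LF \<beta> \<beta>init \<kappa> / 4"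
    unfolding C3_eq by (rule nonzero_mult_div_cancel_left[symmetric]) simp
  finally show ?thesis by simp
qed

lemma rate:
  "objective blk N A F g (x k 0) - optimal_value blk N A F g
     \<le> ereal (real N * C3_const blk N A F g l LF \<beta> \<beta>init \<kappa> / (real k + 4))"
  "(MIN n\<in>{0..k}. opt_measure blk N A F g (x n 0))
     \<le> 2 * real N * C3_const blk N A F g l LF \<beta> \<beta>init \<kappa> / (real k + 4)"
proof -
  let ?Q = "real N * C3_const blk N A F g l LF \<beta> \<beta>init \<kappa>"
  define a where "a n = H (x n 0) - Hmin" for n
  define T where "T n = (\<Sum>i=1..N. S i (x n 0))" for n
  have feas: "x n 0 \<in> X" for n by (rule feasible_iterates) simp
  have a: "0 \<le> a n" "a n \<le> T n" for n
    using Hmin_le[OF feas] H_minus_Hmin_le_sum[OF feas] by (auto simp: a_def T_def)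
  have init: "a 0 \<le> ?Q / 4" using initial_gap by (simp add: a_def)
  have rec: "(T n)\<^sup>2 \<le> ?Q * (a n - a (Suc n))" for n
    using sum_S_squared_le_decrease[of n] by (simp add: a_def T_def)
  have rec_a: "(a n)\<^sup>2 \<le> ?Q * (a n - a (Suc n))" for n
    using power_mono[OF a(2,1), of n 2] rec[of n] by linarith
  have "a k \<le> ?Q / (real k + 4)"
    by (rule sublinear_rate[OF a(1) init rec_a])
  \<comment> \<open>Subtraction is antitone in its second argument, so
    \<open>Hmin \<le> optimal_value\<close> is the direction required.\<close>
  have "objective blk N A F g (x k 0) - optimal_value blk N A F g \<le> ereal (H (x k 0)) - ereal Hmin"
    unfolding objective_eq_H[OF feas] by (intro ereal_minus_mono order_refl Hmin_le_optimal_value)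
  also have "\<dots> \<le> ereal (?Q / (real k + 4))"
    using \<open>a k \<le> ?Q / (real k + 4)\<close> by (simp add: a_def)
  finally show "objective blk N A F g (x k 0) - optimal_value blk N A F g \<le> ereal (?Q / (real k + 4))" .
  obtain n where n: "n \<le> k" "T n \<le> 2 * ?Q / (real k + 4)"
    using sublinear_rate_min[OF a(1) init a(2) rec] by blast
  have "(MIN n\<in>{0..k}. opt_measure blk N A F g (x n 0)) \<le> opt_measure blk N A F g (x n 0)"
    using n(1) by (intro Min_le) auto
  also have "\<dots> \<le> T n"
    unfolding T_def by (rule opt_measure_le_sum[OF feas])
  finally show "(MIN n\<in>{0..k}. opt_measure blk N A F g (x n 0))
     \<le> 2 * real N * C3_const blk N A F g l LF \<beta> \<beta>init \<kappa> / (real k + 4)"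
    using n(2) by (simp add: mult.assoc)
qed

end

theorem theorem4p15:
  fixes blk :: "'d::finite \<Rightarrow> nat" and N :: nat
    and A :: "real^'d^'m::finite" and F :: "real^'m \<Rightarrow> real"
    and g :: "nat \<Rightarrow> real^'d \<Rightarrow> ereal"
    and l \<beta> :: "nat \<Rightarrow> real" and LF \<beta>init \<kappa> :: real
    and x p :: "nat \<Rightarrow> nat \<Rightarrow> real^'d" and \<xi> :: "nat \<Rightarrow> nat \<Rightarrow> int" and k :: nat
  assumes blocks: "range blk \<subseteq> {1..N}"
    and g_proper: "\<And>i. i \<in> {1..N} \<Longrightarrow> proper_on (block_space blk i) (g i)"
    and g_closed: "\<And>i. i \<in> {1..N} \<Longrightarrow> closed_fun_on (block_space blk i) (g i)"
    and g_convex: "\<And>i. i \<in> {1..N} \<Longrightarrow> convex_fun_on (block_space blk i) (g i)"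
    and dom_compact: "\<And>i. i \<in> {1..N} \<Longrightarrow> compact (block_dom blk g i)"
    and g_lipschitz: "\<And>i. i \<in> {1..N} \<Longrightarrow>
          (l i)-lipschitz_on (block_dom blk g i) (\<lambda>y. real_of_ereal (g i y))"
    and F_convex: "convex_on ((*v) A ` feasible blk N g) F"
    and F_C1: "continuously_differentiable_over ((*v) A ` feasible blk N g) F"
    and gradF_lipschitz: "LF-lipschitz_on ((*v) A ` feasible blk N g) (gradient F)"
    and beta_pos: "\<And>i. i \<in> {1..N} \<Longrightarrow> \<beta> i > 0"
    and beta: "\<And>i y h. \<lbrakk>i \<in> {1..N}; y \<in> feasible blk N g; h \<in> block_space blk i;
                 y + h \<in> feasible blk N g\<rbrakk> \<Longrightarrow>
          norm (gradient F (A *v y + block_cols blk i A *v h) - gradient F (A *v y))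
            \<le> \<beta> i * norm (block_cols blk i A *v h)"
    and beta_init: "\<beta>init > 0" and kappa: "\<kappa> > 1"
    and iterates: "cbcg_b_sequence blk N A F g \<beta>init \<kappa> x p \<xi>"
  shows "objective blk N A F g (x k 0) - optimal_value blk N A F g
           \<le> ereal (real N * C3_const blk N A F g l LF \<beta> \<beta>init \<kappa> / (real k + 4))
       \<and> (MIN n\<in>{0..k}. opt_measure blk N A F g (x n 0))
           \<le> 2 * real N * C3_const blk N A F g l LF \<beta> \<beta>init \<kappa> / (real k + 4)"
proof -
  interpret cbcg_b_run blk N A F g l LF \<beta> \<beta>init \<kappa> x p \<xi>
    by unfold_locales
      (fact blocks g_proper g_convex dom_compact g_lipschitz F_convex F_C1 gradF_lipschitz
        beta beta_init kappa iterates)+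
  show ?thesis using rate by blast
qed

end
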